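(* Let $\alpha,\gamma\in\mathbb C$, $z\in\mathbb C\setminus[-1,1]$, $\alpha+\gamma\notin-\mathbb N$. (a) If $\alpha\notin\{-\tfrac12,-\tfrac32,-\tfrac52,\dots\}$ and $2\alpha+\gamma\notin-\mathbb N$, then $$Q_\gamma^{(\alpha,\alpha)}(z)=e^{-i\pi(\alpha+\frac12)}\sqrt\pi\,2^{2\alpha}\,\frac{\Gamma(\alpha+\frac12)\Gamma(\alpha+\gamma+1)}{\Gamma(2\alpha+\gamma+1)}\,D_\gamma^{\alpha+\frac12}(z).$$ (b) If $\alpha\notin\{\tfrac12,\tfrac32,\tfrac52,\dots\}$, $\gamma\notin\{-\tfrac32,-\tfrac52,-\tfrac72,\dots\}$ and $\gamma-\alpha\notin-\mathbb N$, then $$Q_\gamma^{(\alpha,-\alpha)}(z)=e^{i\pi(\alpha-\frac12)}2^{2\gamma-\alpha+1}\,\frac{\Gamma(\alpha+\gamma+1)\Gamma(\frac12-\alpha)\Gamma(\gamma+\frac32)}{\Gamma(2\gamma+2)(z-1)^\alpha}\,D_{\alpha+\gamma}^{\frac12-\alpha}(z).$$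
   Context: $\mathbb N=\{1,2,3,\dots\}$. ${}_2\mathbf F_1(a,b;c;z)=\sum_{k\ge0}\frac{(a)_k(b)_k}{\Gamma(c+k)}\frac{z^k}{k!}$ is the Olver normalized Gauss hypergeometric function, continued analytically to $\mathbb C\setminus[1,\infty)$. Powers are principal; $1/\Gamma$ is $0$ at nonpositive integers. Jacobi function of the second kind ($\alpha+\gamma,\beta+\gamma\notin-\mathbb N$): $Q_\gamma^{(\alpha,\beta)}(z)=\frac{2^{\alpha+\beta+\gamma}\Gamma(\alpha+\gamma+1)\Gamma(\beta+\gamma+1)}{(z-1)^{\alpha+\gamma+1}(z+1)^\beta}{}_2\mathbf F_1\bigl(\gamma+1,\alpha+\gamma+1;\alpha+\beta+2\gamma+2;\tfrac2{1-z}\bigr)$, $z\in\mathbb C\setminus[-1,1]$. Gegenbauer function of the second kind ($\lambda+2\mu\notin-\mathbb N_0$): $D_\lambda^\mu(z)=\frac{e^{i\pi\mu}\Gamma(\lambda+2\mu)}{\Gamma(\mu)(2z)^{\lambda+2\mu}}{}_2\mathbf F_1\bigl(\tfrac12\lambda+\mu,\tfrac12\lambda+\mu+\tfrac12;\lambda+\mu+1;\tfrac1{z^2}\bigr)$, which (for $\lambda+\mu+\frac12\notin-\mathbb N_0$) equals $\frac{e^{i\pi\mu}2^\lambda\Gamma(\lambda+\mu+\frac12)\Gamma(\lambda+2\mu)}{\sqrt\pi\,\Gamma(\mu)(z-1)^{\lambda+\mu+\frac12}(z+1)^{\mu-\frac12}}{}_2\mathbf F_1\bigl(\lambda+1,\lambda+\mu+\tfrac12;2\lambda+2\mu+1;\tfrac2{1-z}\bigr)$.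 *)

theory Defs
  imports "HOL-Complex_Analysis.Complex_Analysis"
begin

text \<open>
  Conventions.  \<open>powr\<close> on complex numbers is the principal power.  In the library
  \<open>Gamma\<close> takes the value 0 at its poles, so \<open>x / Gamma w\<close> is 0 for every
  nonpositive integer \<open>w\<close>, in agreement with the convention \<open>1/\<Gamma> = 0\<close> there.
\<close>

definition olver_2F1_series :: "complex \<Rightarrow> complex \<Rightarrow> complex \<Rightarrow> complex \<Rightarrow> complex" where
  "olver_2F1_series a b c z =
     (\<Sum>k. pochhammer a k * pochhammer b k * rGamma (c + of_nat k) * z ^ k / fact k)"

definition cut_plane :: "complex set" where
  "cut_plane = - (complex_of_real ` {1..})"

text \<open>
  The analytic continuation of the series from the unit disc.  By the identity theorem
  it is determined on \<open>cut_plane\<close>, the only region where the values are meaningful.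
\<close>

definition olver_2F1 :: "complex \<Rightarrow> complex \<Rightarrow> complex \<Rightarrow> complex \<Rightarrow> complex" where
  "olver_2F1 a b c =
     (SOME F. F holomorphic_on cut_plane \<and> (\<forall>z\<in>ball 0 1. F z = olver_2F1_series a b c z))"

text \<open>
  Jacobi function of the second kind, argument order \<open>\<gamma> \<alpha> \<beta> z\<close>.  Meaningful for
  \<open>\<alpha> + \<gamma>\<close> and \<open>\<beta> + \<gamma>\<close> not in \<open>{-1, -2, \<dots>}\<close> and \<open>z\<close> outside the real segment \<open>[-1, 1]\<close>.
\<close>

definition jacobi_Q :: "complex \<Rightarrow> complex \<Rightarrow> complex \<Rightarrow> complex \<Rightarrow> complex" where
  "jacobi_Q \<gamma> \<alpha> \<beta> z =
     2 powr (\<alpha> + \<beta> + \<gamma>) * Gamma (\<alpha> + \<gamma> + 1) * Gamma (\<beta> + \<gamma> + 1)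
       / ((z - 1) powr (\<alpha> + \<gamma> + 1) * (z + 1) powr \<beta>)
       * olver_2F1 (\<gamma> + 1) (\<alpha> + \<gamma> + 1) (\<alpha> + \<beta> + 2 * \<gamma> + 2) (2 / (1 - z))"

text \<open>
  Gegenbauer function of the second kind, argument order \<open>\<lambda> \<mu> z\<close> with \<open>\<lambda>\<close> written \<open>l\<close>.
  Meaningful for \<open>l + 2 \<mu>\<close> not in \<open>{0, -1, -2, \<dots>}\<close> and \<open>z\<close> outside the real segment
  \<open>[-1, 1]\<close>.
\<close>

definition gegenbauer_D :: "complex \<Rightarrow> complex \<Rightarrow> complex \<Rightarrow> complex" where
  "gegenbauer_D l \<mu> z =
     exp (\<i> * of_real pi * \<mu>) * Gamma (l + 2 * \<mu>)
       / (Gamma \<mu> * (2 * z) powr (l + 2 * \<mu>))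
       * olver_2F1 (l / 2 + \<mu>) (l / 2 + \<mu> + 1 / 2) (l + \<mu> + 1) (1 / z\<^sup>2)"

end

theory Submission
  imports Defs
begin

text \<open>
  Both parts are one quadratic transformation of the hypergeometric function:
  \<open>F(a, b; 2 b; 2 / (1 - z))\<close> equals
  \<open>F(b - a/2, b - a/2 + 1/2; b + 1/2; 1 / z\<^sup>2)\<close> times
  \<open>\<surd>\<pi> 2\<^bsup>1 - 2 b\<^esup> (z - 1)\<^bsup>b\<^esup> (z + 1)\<^bsup>b - a\<^esup> / (\<Gamma>(b) z\<^bsup>2 b - a\<^esup>)\<close>, for all complex \<open>a\<close>, \<open>b\<close> and all \<open>z\<close> off
  \<open>[-1, 1]\<close> (lemma \<open>olver_2F1_on_exterior\<close>).  The Jacobi function has the parameters of the first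
  function exactly when its two upper indices are equal (then \<open>b = \<alpha> + \<gamma> + 1\<close>) or opposite (then
  \<open>b = \<gamma> + 1\<close>), and the Gegenbauer function is defined by the second.  Duplication of \<open>\<Gamma>\<close> matches the
  constants.

  The transformation is the composition of Pfaff's transformation with
  \<open>(1 + y)\<^bsup>-a\<^esup> F(a, b; 2 b; 2 y / (1 + y)) = \<surd>\<pi> 2\<^bsup>1 - 2 b\<^esup> / \<Gamma>(b) F(a/2, a/2 + 1/2; b + 1/2; y\<^sup>2)\<close>.  Both are
  identities of power series.  In each of them one numerator parameter factors out of the
  coefficients (\<open>euler_transform_coefficient\<close>), and there remains a binomial transform of
  the sequence formed from the other parameters.  These transforms have closed forms, by induction
  on the index with shifted parameters (\<open>vandermonde_rGamma\<close>, \<open>quadratic_coefficients\<close>).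
  Because the series are normalized by \<open>1 / \<Gamma>\<close>, the induction steps are valid for all complex
  parameters, and the identities include the degenerate cases.

  To leave the neighbourhood of the origin one needs analytic continuations to the cut plane.
  For the parameters \<open>(A, A + 1/2; C)\<close> one is given explicitly by
  \<open>F(A, A + 1/2; C; 4 x / (1 + x)\<^sup>2) = (1 + x)\<^bsup>2 A\<^esup> F(2 A, 2 A - C + 1; C; x)\<close>, since \<open>4 x / (1 + x)\<^sup>2\<close> maps the
  unit disc conformally onto the cut plane; for \<open>(a, b; 2 b)\<close> one then follows from the
  quadratic transformation.  The identity theorem in the variable \<open>y = 1 / z\<close> extends the
  transformation to the exterior of \<open>[-1, 1]\<close>, and there the principal powers of \<open>1 \<plusminus> y\<close> are
  quotients of principal powers of \<open>z \<plusminus> 1\<close> and \<open>z\<close>, even for \<open>z < -1\<close>.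
\<close>

section \<open>Binomial transforms of hypergeometric coefficients\<close>

text \<open>
  The numbers \<open>(p + q E)\<^sup>n u\<close> at index \<open>0\<close>, where \<open>E\<close> is the shift of sequences.  They are the
  coefficients produced by a substitution \<open>x \<mapsto> q x / (1 - p x)\<close> in a power series.
\<close>

definition binomial_transform :: "complex \<Rightarrow> complex \<Rightarrow> (nat \<Rightarrow> complex) \<Rightarrow> nat \<Rightarrow> complex" where
  "binomial_transform p q u n = (\<Sum>k\<le>n. of_nat (n choose k) * p ^ (n - k) * q ^ k * u k)"

lemma binomial_transform_0 [simp]: "binomial_transform p q u 0 = u 0"
  by (simp add: binomial_transform_def)

text \<open>
  One factor \<open>p + q E\<close> is split off and applied to the sequence first.  All closed forms below
  follow by induction from this rule, because one or two factors turn a hypergeometric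
  sequence into a multiple of the same kind of sequence with shifted parameters.
\<close>

lemma binomial_transform_Suc:
  "binomial_transform p q u (Suc n) = binomial_transform p q (\<lambda>k. p * u k + q * u (Suc k)) n"
proof -
  define T where "T = (\<Sum>k\<le>Suc n. of_nat (n choose k) * p ^ (Suc n - k) * q ^ k * u k)"
  have T1: "T = (\<Sum>k\<le>n. of_nat (n choose k) * p ^ (n - k) * q ^ k * (p * u k))"
    unfolding T_def by (simp add: Suc_diff_le mult_ac)
  have T2: "T = p ^ Suc n * u 0 +
      (\<Sum>k\<le>n. of_nat (n choose Suc k) * p ^ (n - k) * q ^ Suc k * u (Suc k))"
    unfolding T_def by (subst sum.atMost_Suc_shift) simp
  have "binomial_transform p q u (Suc n) = p ^ Suc n * u 0 +
      (\<Sum>k\<le>n. of_nat (Suc n choose Suc k) * p ^ (n - k) * q ^ Suc k * u (Suc k))"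
    unfolding binomial_transform_def by (subst sum.atMost_Suc_shift) simp
  also have "\<dots> = T + (\<Sum>k\<le>n. of_nat (n choose k) * p ^ (n - k) * q ^ Suc k * u (Suc k))"
    unfolding T2 by (simp add: sum.distrib algebra_simps)
  finally show ?thesis
    unfolding T1 binomial_transform_def by (simp add: sum.distrib algebra_simps)
qed

lemma binomial_transform_cmult:
  "binomial_transform p q (\<lambda>k. x * u k) n = x * binomial_transform p q u n"
  by (simp add: binomial_transform_def sum_distrib_left mult_ac)

lemma binomial_transform_diff:
  "binomial_transform p q (\<lambda>k. u k - v k) n = binomial_transform p q u n - binomial_transform p q v n"
  by (simp add: binomial_transform_def sum_subtractf algebra_simps)

lemma rGamma_step: "rGamma (c + of_nat k) = (c + of_nat k) * rGamma (c + 1 + of_nat k :: complex)"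
  using rGamma_plus1[of "c + of_nat k"] by (simp add: add_ac)

text \<open>
  The Chu--Vandermonde sum in the normalization by \<open>rGamma\<close>: the operator \<open>1 - E\<close> multiplies the sequence by \<open>c - a\<close> and raises \<open>c\<close> by one.
\<close>

lemma vandermonde_rGamma:
  fixes a c :: complex
  shows "binomial_transform 1 (-1) (\<lambda>k. pochhammer a k * rGamma (c + of_nat k)) n
           = pochhammer (c - a) n * rGamma (c + of_nat n)"
proof (induction n arbitrary: c)
  case (Suc n)
  have "(\<lambda>k. 1 * (pochhammer a k * rGamma (c + of_nat k))
           + -1 * (pochhammer a (Suc k) * rGamma (c + of_nat (Suc k))))
         = (\<lambda>k. (c - a) * (pochhammer a k * rGamma (c + 1 + of_nat k)))"
    by (simp add: rGamma_step[of c] pochhammer_Suc algebra_simps fun_eq_iff)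
  then have "binomial_transform 1 (-1) (\<lambda>k. pochhammer a k * rGamma (c + of_nat k)) (Suc n)
               = (c - a) * (pochhammer (c + 1 - a) n * rGamma (c + 1 + of_nat n))"
    unfolding binomial_transform_Suc using Suc[of "c + 1"]
    by (simp only: binomial_transform_cmult)
  also have "\<dots> = pochhammer (c - a) (Suc n) * rGamma (c + of_nat (Suc n))"
    by (simp add: pochhammer_rec algebra_simps)
  finally show ?case .
qed simp

text \<open>
  The reciprocal form of Legendre's duplication formula extends to the poles: if \<open>b\<close> or \<open>b + 1/2\<close> is
  a pole of \<open>\<Gamma>\<close>, then so is \<open>2 * b\<close>, and both sides vanish.
\<close>

lemma rGamma_legendre_duplication:
  fixes b :: complex
  shows "rGamma (2 * b) = of_real (sqrt pi) * 2 powr (1 - 2 * b) * rGamma b * rGamma (b + 1/2)"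
proof (cases "b \<in> \<int>\<^sub>\<le>\<^sub>0 \<or> b + 1/2 \<in> \<int>\<^sub>\<le>\<^sub>0")
  case True
  then have "2 * b \<in> \<int>\<^sub>\<le>\<^sub>0"
  proof
    assume "b + 1/2 \<in> \<int>\<^sub>\<le>\<^sub>0"
    then obtain n where n: "b + 1/2 = - of_nat n" by (auto elim: nonpos_Ints_cases')
    have "2 * b = 2 * (b + 1/2) - 1" by simp
    then have "2 * b = - of_nat (2 * n + 1)" unfolding n by simp
    then show ?thesis by (metis minus_of_nat_in_nonpos_Ints)
  next
    assume "b \<in> \<int>\<^sub>\<le>\<^sub>0"
    then obtain n where n: "b = - of_nat n" by (auto elim: nonpos_Ints_cases')
    then have "2 * b = - of_nat (2 * n)" by simp
    then show ?thesis by (metis minus_of_nat_in_nonpos_Ints)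
  qed
  then have "rGamma (2 * b) = 0" by (simp add: rGamma_eq_zero_iff)
  moreover have "rGamma b = 0 \<or> rGamma (b + 1/2) = 0"
    using True by (simp add: rGamma_eq_zero_iff)
  ultimately show ?thesis by auto
next
  case False
  then have "2 * b \<notin> \<int>\<^sub>\<le>\<^sub>0" using double_in_nonpos_Ints_imp[of b] by auto
  then have nz: "Gamma b \<noteq> 0" "Gamma (b + 1/2) \<noteq> 0" "Gamma (2 * b) \<noteq> 0"
    using False by (auto simp: Gamma_eq_zero_iff)
  have "Gamma b * Gamma (b + 1/2) = 2 powr (1 - 2 * b) * of_real (sqrt pi) * Gamma (2 * b)"
    using Gamma_legendre_duplication[of b] False by (simp add: powr_def Ln_of_real flip: Ln_of_real)
  with nz show ?thesis by (simp add: rGamma_inverse_Gamma field_simps)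
qed

text \<open>
  The quotient \<open>\<Gamma>(b + 1/2) / \<Gamma>(2 b)\<close>, written by the duplication formula so that it is an
  entire function of \<open>b\<close>.
\<close>

definition quad_const :: "complex \<Rightarrow> complex" where
  "quad_const b = of_real (sqrt pi) * 2 powr (1 - 2 * b) * rGamma b"

lemma quad_const_plus1: "4 * b\<^sup>2 * quad_const (b + 1) = b * quad_const b"
proof -
  have "(2::complex) powr (1 - 2 * b) = 2 powr (1 - 2 * (b + 1)) * 2 powr 2"
    by (subst powr_add [symmetric]) (simp add: algebra_simps)
  then show ?thesis
    using rGamma_plus1[of b] by (simp add: quad_const_def power2_eq_square)
qed

text \<open>
  Up to a factor, \<open>u b k\<close> is the Beta integral of \<open>t\<^sup>k (t (1 - t)) powr (b - 1)\<close>, and \<open>2 E - 1\<close> is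
  multiplication of the integrand by \<open>2 t - 1\<close>.  The identity \<open>(2 t - 1)\<^sup>2 = 1 - 4 t (1 - t)\<close> therefore
  suggests that \<open>(2 E - 1)\<^sup>2\<close> combines the sequences for \<open>b\<close> and \<open>b + 1\<close>.  The proof checks this on
  the coefficients, so it covers every complex \<open>b\<close>, also where the integral diverges.
\<close>

lemma quadratic_coefficients_step:
  fixes b :: complex
  defines "u \<equiv> \<lambda>b k. pochhammer b k * rGamma (2 * b + of_nat k)"
  shows "binomial_transform (-1) 2 (u b) (Suc (Suc n)) =
           binomial_transform (-1) 2 (u b) n - 4 * b\<^sup>2 * binomial_transform (-1) 2 (u (b + 1)) n"
proof -
  have "-1 * (-1 * u b k + 2 * u b (Suc k)) + 2 * (-1 * u b (Suc k) + 2 * u b (Suc (Suc k)))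
          = u b k - 4 * b\<^sup>2 * u (b + 1) k" for k
  proof -
    define R where "R = rGamma (2 * b + of_nat k + 2)"
    have u2: "u b (Suc (Suc k)) = b * pochhammer (b + 1) k * (b + of_nat k + 1) * R"
      unfolding u_def pochhammer_rec[of b "Suc k"] pochhammer_Suc[of "b + 1"]
      by (simp add: R_def algebra_simps)
    have u1: "u b (Suc k) = b * pochhammer (b + 1) k * ((2 * b + of_nat k + 1) * R)"
      using rGamma_plus1[of "2 * b + of_nat k + 1"] by (simp add: u_def R_def pochhammer_rec add_ac)
    have u': "u (b + 1) k = pochhammer (b + 1) k * R"
      by (simp add: u_def R_def algebra_simps)
    show ?thesis unfolding u1 u2 u' by (simp add: algebra_simps power2_eq_square)
  qed
  then show ?thesis
    unfolding binomial_transform_Suc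
    by (simp only: binomial_transform_diff binomial_transform_cmult)
qed

text \<open>
  Up to a factor, the terminating sum \<open>F(-n, b; 2 b; 2)\<close>.  It vanishes for odd \<open>n\<close>, as the integral of an odd
  function of \<open>2 t - 1\<close> does; this is what makes the transformed series a series in \<open>y\<^sup>2\<close>.
\<close>

lemma quadratic_coefficients:
  fixes b :: complex
  defines "u \<equiv> \<lambda>b k. pochhammer b k * rGamma (2 * b + of_nat k)"
  shows quadratic_coefficients_even: "binomial_transform (-1) 2 (u b) (2 * m) =
           quad_const b * pochhammer (1/2) m * rGamma (b + 1/2 + of_nat m)"
    and quadratic_coefficients_odd: "binomial_transform (-1) 2 (u b) (Suc (2 * m)) = 0"
proof -
  show "binomial_transform (-1) 2 (u b) (2 * m) =
           quad_const b * pochhammer (1/2) m * rGamma (b + 1/2 + of_nat m)"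
  proof (induction m arbitrary: b)
    case 0
    show ?case by (simp add: u_def quad_const_def rGamma_legendre_duplication)
  next
    case (Suc m)
    define R where "R = rGamma (b + 1/2 + of_nat (Suc m))"
    have R: "rGamma (b + 1/2 + of_nat m) = (b + 1/2 + of_nat m) * R"
      "rGamma (b + 1 + 1/2 + of_nat m) = R"
      using rGamma_step[of "b + 1/2" m] by (simp_all add: R_def add_ac)
    have "binomial_transform (-1) 2 (u b) (2 * Suc m) =
       quad_const b * pochhammer (1/2) m * ((b + 1/2 + of_nat m) * R)
         - (4 * b\<^sup>2 * quad_const (b + 1)) * pochhammer (1/2) m * R"
      using quadratic_coefficients_step[of b "2 * m"] Suc[of b] Suc[of "b + 1"] R
      by (simp add: u_def)
    also have "\<dots> = quad_const b * pochhammer (1/2) (Suc m) * R"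
      unfolding quad_const_plus1 by (simp add: pochhammer_Suc algebra_simps)
    finally show ?case by (simp add: R_def)
  qed
  show "binomial_transform (-1) 2 (u b) (Suc (2 * m)) = 0"
  proof (induction m arbitrary: b)
    case 0
    show ?case
      using rGamma_plus1[of "2 * b"] by (simp add: u_def binomial_transform_def mult_ac)
  next
    case (Suc m)
    then show ?case
      using quadratic_coefficients_step[of b "Suc (2 * m)"] Suc[of "b + 1"] by (simp add: u_def)
  qed
qed

section \<open>The hypergeometric series and its binomial substitutions\<close>

definition olver_fps :: "complex \<Rightarrow> complex \<Rightarrow> complex \<Rightarrow> complex fps" where
  "olver_fps a b c =
     Abs_fps (\<lambda>k. pochhammer a k * pochhammer b k * rGamma (c + of_nat k) / fact k)"

lemma olver_2F1_series_eq_eval_fps: "olver_2F1_series a b c z = eval_fps (olver_fps a b c) z"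
  by (simp add: olver_2F1_series_def eval_fps_def olver_fps_def)

text \<open>
  The ratio test applies even when the coefficients vanish from some index on, since it is used
  in the form \<open>u (k + 1) = t k * u k\<close> with \<open>t k\<close> tending to \<open>1\<close>.
\<close>

lemma fps_conv_radius_olver_fps: "fps_conv_radius (olver_fps a b c) \<ge> 1"
  unfolding fps_conv_radius_def one_ereal_def
proof (rule conv_radius_geI_ex)
  fix r :: real
  assume r: "0 < r" "ereal r < ereal 1"
  define u where "u = (\<lambda>k. fps_nth (olver_fps a b c) k)"
  define t where "t = (\<lambda>k. (a + of_nat k) * (b + of_nat k) / ((c + of_nat k) * (1 + of_nat k)))"
  have lim1: "(\<lambda>k. (a + of_nat k) / (c + of_nat k)) \<longlonglongrightarrow> 1" for a c :: complex
  proof -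
    have "(\<lambda>k. 1 + (a - c) * inverse (c + of_nat k)) \<longlonglongrightarrow> 1 + (a - c) * 0"
      by (intro tendsto_intros filterlim_compose[OF tendsto_inverse_0]
            tendsto_add_filterlim_at_infinity[OF tendsto_const] tendsto_of_nat)
    moreover have "eventually (\<lambda>k. 1 + (a - c) * inverse (c + of_nat k)
                     = (a + of_nat k) / (c + of_nat k)) sequentially"
    proof -
      obtain N :: nat where N: "norm c < of_nat N" using reals_Archimedean2 by blast
      show ?thesis
        using eventually_ge_at_top[of N]
      proof eventually_elim
        case (elim k)
        have "c + of_nat k \<noteq> 0"
        proof
          assume "c + of_nat k = 0"
          then have "norm c = of_nat k" by (metis add_eq_0_iff norm_minus_cancel norm_of_nat)
          then show False using N elim by simp
        qed
        then show ?case by (simp add: field_simps)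
      qed
    qed
    ultimately show ?thesis by (simp add: tendsto_cong)
  qed
  have "(\<lambda>k. ((a + of_nat k) / (c + of_nat k)) * ((b + of_nat k) / (1 + of_nat k))) \<longlonglongrightarrow> 1 * 1"
    by (intro tendsto_mult lim1)
  then have "(\<lambda>k. norm (t k)) \<longlonglongrightarrow> norm (1 :: complex)"
    unfolding t_def by (intro tendsto_norm) simp
  then have "(\<lambda>k. norm (t k) * r) \<longlonglongrightarrow> 1 * r"
    by (intro tendsto_intros) simp
  moreover define q where "q = (1 + r) / 2"
  have q: "r < q" "q < 1" using r by (auto simp: q_def)
  ultimately have ev: "eventually (\<lambda>k. norm (t k) * r < q) sequentially"
    by (intro order_tendstoD(2)) auto
  obtain N :: nat where N: "norm c < of_nat N" using reals_Archimedean2 by blast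
  obtain M where M: "\<And>k. k \<ge> M \<Longrightarrow> norm (t k) * r < q"
    using ev unfolding eventually_sequentially by blast
  have "summable (\<lambda>k. u k * of_real r ^ k)"
  proof (rule summable_ratio_test[of q "max M N"])
    fix k assume k: "max M N \<le> k"
    have nz: "c + of_nat k \<noteq> 0"
    proof
      assume "c + of_nat k = 0"
      then have "norm c = of_nat k" by (metis add_eq_0_iff norm_minus_cancel norm_of_nat)
      then show False using N k by simp
    qed
    then have g: "rGamma (c + of_nat (Suc k)) = rGamma (c + of_nat k) / (c + of_nat k)"
      using rGamma_step[of c k] by (simp add: field_simps)
    have "(1 :: complex) + of_nat k \<noteq> 0"
      using of_nat_neq_0[of k] by simp
    then have "u (Suc k) = t k * u k"
      using nz unfolding u_def t_def olver_fps_def fps_nth_Abs_fps g by (simp add: pochhammer_Suc field_simps)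
    then have "norm (u (Suc k) * of_real r ^ Suc k) = (norm (t k) * r) * norm (u k * of_real r ^ k)"
      using r by (simp add: norm_mult norm_power)
    also have "\<dots> \<le> q * norm (u k * of_real r ^ k)"
      using M[of k] k by (intro mult_right_mono) auto
    finally show "norm (u (Suc k) * of_real r ^ Suc k) \<le> q * norm (u k * of_real r ^ k)" .
  qed (use q in auto)
  then show "\<exists>z. norm z = r \<and> summable (\<lambda>n. fps_nth (olver_fps a b c) n * z ^ n)"
    using r by (intro exI[of _ "of_real r"]) (auto simp: u_def)
qed

lemma has_fps_expansion_olver_series:
  "olver_2F1_series a b c has_fps_expansion olver_fps a b c"
  unfolding has_fps_expansion_def olver_2F1_series_eq_eval_fps
  using fps_conv_radius_olver_fps[of a b c] by (auto simp: order_less_le_trans[of 0 1])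

lemma olver_2F1_series_holomorphic: "olver_2F1_series a b c holomorphic_on ball 0 1"
proof -
  have "ball (0 :: complex) 1 \<subseteq> eball 0 (fps_conv_radius (olver_fps a b c))"
  proof
    fix x :: complex
    assume "x \<in> ball 0 1"
    then have "ereal (norm x) < 1" by (simp add: one_ereal_def)
    also note fps_conv_radius_olver_fps[of a b c]
    finally show "x \<in> eball 0 (fps_conv_radius (olver_fps a b c))" by (simp add: in_eball_iff)
  qed
  then have "eval_fps (olver_fps a b c) holomorphic_on ball 0 1"
    by (rule holomorphic_on_eval_fps)
  then show ?thesis by (simp add: olver_2F1_series_eq_eval_fps[abs_def])
qed

lemma has_fps_expansion_transfer:
  assumes "f has_fps_expansion F" "eventually (\<lambda>x. f x = g x) (nhds 0)"
  shows "g has_fps_expansion F"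
  using has_fps_expansion_cong[OF assms(2) refl] assms(1) by simp

lemma has_fps_expansion_binomial_scaled:
  fixes p s :: complex
  shows "(\<lambda>x. (1 + p * x) powr s) has_fps_expansion fps_compose (fps_binomial s) (fps_const p * fps_X)"
proof -
  have "(\<lambda>x. p * x) has_fps_expansion fps_const p * fps_X"
    by (rule has_fps_expansion_cmult_left[OF has_fps_expansion_fps_X])
  from has_fps_expansion_compose[OF has_fps_expansion_binomial_complex this]
  show ?thesis by (simp add: o_def)
qed

text \<open>
  The \<open>k\<close>-th term of \<open>f (q x / (1 + p x)\<^sup>r)\<close>, multiplied by the prefactor, is
  \<open>F\<^sub>k q\<^sup>k x\<^sup>k (1 + p x) powr (- s - r k)\<close>, again a binomial series.  Since the substituted function vanishes at
  the origin, only the terms with \<open>k \<le> n\<close> contribute to the coefficient of \<open>x\<^sup>n\<close>, and the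
  rearrangement is one of finite sums.
\<close>

lemma has_fps_expansion_binomial_substitution:
  fixes p q s :: complex and r :: nat
  assumes F: "f has_fps_expansion F"
  shows "(\<lambda>x. (1 + p * x) powr (- s) * f (q * x / (1 + p * x) ^ r)) has_fps_expansion
           Abs_fps (\<lambda>n. \<Sum>k\<le>n. fps_nth F k * q ^ k * (- p) ^ (n - k)
                       * pochhammer (s + of_nat (r * k)) (n - k) / fact (n - k))"
proof -
  define B where "B = (\<lambda>s. fps_compose (fps_binomial (- s)) (fps_const p * fps_X))"
  have B: "(\<lambda>x. (1 + p * x) powr (- s)) has_fps_expansion B s" for s
    unfolding B_def by (rule has_fps_expansion_binomial_scaled)
  have B_nth: "fps_nth (B s) m = (- p) ^ m * pochhammer s m / fact m" for s m
    unfolding B_def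
    by (simp add: fps_compose_linear gbinomial_pochhammer fps_binomial_def flip: power_mult_distrib)
  \<comment> \<open>the expansion of the inner function; its \<open>k\<close>-th power times \<open>B s\<close> is a monomial times \<open>B (s + r k)\<close>\<close>
  define \<Phi> where "\<Phi> = fps_const q * fps_X * B (of_nat r)"
  have nz: "eventually (\<lambda>x. 1 + p * x \<noteq> 0) (nhds 0)"
  proof -
    have "((\<lambda>x. 1 + p * x) \<longlongrightarrow> 1 + p * 0) (nhds 0)" by (intro tendsto_intros filterlim_ident)
    from tendsto_imp_eventually_ne[OF this, of 0] show ?thesis by simp
  qed
  have \<Phi>: "(\<lambda>x. q * x / (1 + p * x) ^ r) has_fps_expansion \<Phi>"
  proof -
    have "(\<lambda>x. q * x * (1 + p * x) powr (- of_nat r)) has_fps_expansion \<Phi>"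
      unfolding \<Phi>_def by (intro fps_expansion_intros B)
    moreover have "eventually (\<lambda>x. q * x * (1 + p * x) powr (- of_nat r) = q * x / (1 + p * x) ^ r) (nhds 0)"
      using nz by eventually_elim (simp add: powr_minus powr_nat divide_inverse)
    ultimately show ?thesis by (rule has_fps_expansion_transfer)
  qed
  have \<Phi>0: "fps_nth \<Phi> 0 = 0" by (simp add: \<Phi>_def mult.assoc)
  have power: "\<Phi> ^ k * B s = fps_const (q ^ k) * (fps_X ^ k * B (s + of_nat (r * k)))" for k
  proof (rule fps_expansion_unique_complex)
    show "(\<lambda>x. (q * x / (1 + p * x) ^ r) ^ k * (1 + p * x) powr (- s)) has_fps_expansion \<Phi> ^ k * B s"
      by (intro fps_expansion_intros B \<Phi>)
    have "(\<lambda>x. q ^ k * (x ^ k * (1 + p * x) powr (- (s + of_nat (r * k))))) has_fps_expansion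
            fps_const (q ^ k) * (fps_X ^ k * B (s + of_nat (r * k)))"
      by (intro fps_expansion_intros B)
    moreover have "eventually (\<lambda>x. q ^ k * (x ^ k * (1 + p * x) powr (- (s + of_nat (r * k)))) =
        (q * x / (1 + p * x) ^ r) ^ k * (1 + p * x) powr (- s)) (nhds 0)"
      using nz
    proof eventually_elim
      case (elim x)
      have "(1 + p * x) powr (- (s + of_nat (r * k)))
              = (1 + p * x) powr (- s) * (1 + p * x) powr (- of_nat (r * k))"
        by (subst powr_add [symmetric]) simp
      also have "(1 + p * x) powr (- of_nat (r * k)) = inverse ((1 + p * x) ^ (r * k))"
        using elim by (simp add: powr_minus powr_nat del: of_nat_mult)
      finally show ?case
        by (simp add: power_mult power_divide power_mult_distrib divide_inverse power_inverse)
    qed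
    ultimately show "(\<lambda>x. (q * x / (1 + p * x) ^ r) ^ k * (1 + p * x) powr (- s)) has_fps_expansion
            fps_const (q ^ k) * (fps_X ^ k * B (s + of_nat (r * k)))"
      by (rule has_fps_expansion_transfer)
  qed
  have "(\<lambda>x. (1 + p * x) powr (- s) * (f \<circ> (\<lambda>x. q * x / (1 + p * x) ^ r)) x) has_fps_expansion
          B s * fps_compose F \<Phi>"
    by (intro has_fps_expansion_mult B has_fps_expansion_compose F \<Phi> \<Phi>0)
  moreover have "B s * fps_compose F \<Phi> = Abs_fps (\<lambda>n. \<Sum>k\<le>n. fps_nth F k * q ^ k * (- p) ^ (n - k)
                       * pochhammer (s + of_nat (r * k)) (n - k) / fact (n - k))"
  proof (rule fps_ext)
    fix n
    have "fps_nth (B s * fps_compose F \<Phi>) n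
        = (\<Sum>i=0..n. (\<Sum>k=0..i. fps_nth F k * fps_nth (\<Phi> ^ k) i) * fps_nth (B s) (n - i))"
      by (subst mult.commute) (simp add: fps_mult_nth fps_compose_nth)
    also have "\<dots> = (\<Sum>i=0..n. (\<Sum>k=0..n. fps_nth F k * fps_nth (\<Phi> ^ k) i) * fps_nth (B s) (n - i))"
      using startsby_zero_power_prefix[OF \<Phi>0]
      by (intro sum.cong refl arg_cong2[where f = "(*)"] sum.mono_neutral_left) auto
    also have "\<dots> = (\<Sum>k=0..n. fps_nth F k * (\<Sum>i=0..n. fps_nth (\<Phi> ^ k) i * fps_nth (B s) (n - i)))"
      unfolding sum_distrib_left sum_distrib_right
      by (subst sum.swap) (simp add: mult_ac)
    also have "\<dots> = (\<Sum>k=0..n. fps_nth F k * fps_nth (\<Phi> ^ k * B s) n)"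
      by (simp add: fps_mult_nth)
    also have "\<dots> = (\<Sum>k\<le>n. fps_nth F k * q ^ k * (- p) ^ (n - k)
                       * pochhammer (s + of_nat (r * k)) (n - k) / fact (n - k))"
      unfolding power
      by (intro sum.cong) (auto simp: fps_X_power_mult_nth B_nth)
    finally show "fps_nth (B s * fps_compose F \<Phi>) n = fps_nth (Abs_fps (\<lambda>n. \<Sum>k\<le>n. fps_nth F k * q ^ k * (- p) ^ (n - k)
                       * pochhammer (s + of_nat (r * k)) (n - k) / fact (n - k))) n" by simp
  qed
  ultimately show ?thesis by (simp add: o_def)
qed

text \<open>
  For \<open>r = 1\<close> and \<open>s\<close> equal to one numerator parameter, that parameter factors out of the sum:
  what remains is a binomial transform that does not involve \<open>s\<close>.
\<close>

lemma euler_transform_coefficient: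
  "(\<Sum>k\<le>n. (pochhammer s k * u k / fact k) * q ^ k * (- p) ^ (n - k)
        * pochhammer (s + of_nat k) (n - k) / fact (n - k))
     = pochhammer s n / fact n * binomial_transform (- p) q u n"
  unfolding binomial_transform_def sum_distrib_left
proof (intro sum.cong refl)
  fix k assume "k \<in> {..n}"
  then have k: "k \<le> n" by simp
  then have 1: "pochhammer s n = pochhammer s k * pochhammer (s + of_nat k) (n - k)"
    by (rule pochhammer_product)
  have 2: "of_nat (n choose k) = (fact n / (fact k * fact (n - k)) :: complex)"
    using k by (rule binomial_fact)
  show "(pochhammer s k * u k / fact k) * q ^ k * (- p) ^ (n - k)
        * pochhammer (s + of_nat k) (n - k) / fact (n - k)
     = pochhammer s n / fact n * (of_nat (n choose k) * (- p) ^ (n - k) * q ^ k * u k)"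
    unfolding 1 2 by simp
qed

section \<open>Three transformations near the origin\<close>

text \<open>
  Pfaff's transformation.  The parameter \<open>b\<close> factors out, and the remaining sum is
  Chu--Vandermonde.
\<close>

lemma pfaff_near_0:
  "eventually (\<lambda>x. (1 - x) powr (- b) * olver_2F1_series a b c (- x / (1 - x))
                 = olver_2F1_series (c - a) b c x) (nhds 0)"
proof -
  define L where "L = Abs_fps (\<lambda>n. \<Sum>k\<le>n. fps_nth (olver_fps a b c) k * (-1) ^ k * (- (-1)) ^ (n - k)
                       * pochhammer (b + of_nat (1 * k)) (n - k) / fact (n - k))"
  have "(\<lambda>x. (1 + (-1) * x) powr (- b) * olver_2F1_series a b c ((-1) * x / (1 + (-1) * x) ^ 1))
          has_fps_expansion L"
    unfolding L_def
    by (rule has_fps_expansion_binomial_substitution[OF has_fps_expansion_olver_series])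
  then have L: "(\<lambda>x. (1 - x) powr (- b) * olver_2F1_series a b c (- x / (1 - x))) has_fps_expansion L"
    by simp
  have "L = olver_fps (c - a) b c"
  proof (rule fps_ext)
    fix n
    have "fps_nth L n
          = (\<Sum>k\<le>n. (pochhammer b k * (pochhammer a k * rGamma (c + of_nat k)) / fact k) * (-1) ^ k
                * (- (-1)) ^ (n - k) * pochhammer (b + of_nat k) (n - k) / fact (n - k))"
      by (simp add: L_def olver_fps_def mult_ac)
    also have "\<dots> = pochhammer b n / fact n * (pochhammer (c - a) n * rGamma (c + of_nat n))"
      unfolding euler_transform_coefficient by (simp add: vandermonde_rGamma)
    finally show "fps_nth L n = fps_nth (olver_fps (c - a) b c) n"
      by (simp add: olver_fps_def)
  qed
  with L has_fps_expansion_olver_series[of "c - a" b c] show ?thesis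
    unfolding has_fps_expansion_def by (auto elim: eventually_elim2)
qed

text \<open>
  Here \<open>a\<close> factors out, and the remaining sum depends on \<open>b\<close> only; it is the one evaluated in
  \<open>quadratic_coefficients\<close>.
\<close>

lemma quadratic_near_0:
  "eventually (\<lambda>y. (1 + y) powr (- a) * olver_2F1_series a b (2 * b) (2 * y / (1 + y))
      = quad_const b * olver_2F1_series (a / 2) (a / 2 + 1 / 2) (b + 1 / 2) (y\<^sup>2)) (nhds 0)"
proof -
  define L where "L = Abs_fps (\<lambda>n. \<Sum>k\<le>n. fps_nth (olver_fps a b (2 * b)) k * 2 ^ k * (- 1) ^ (n - k)
                       * pochhammer (a + of_nat (1 * k)) (n - k) / fact (n - k))"
  have "(\<lambda>y. (1 + 1 * y) powr (- a) * olver_2F1_series a b (2 * b) (2 * y / (1 + 1 * y) ^ 1))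
          has_fps_expansion L"
    unfolding L_def
    by (rule has_fps_expansion_binomial_substitution[OF has_fps_expansion_olver_series])
  then have L: "(\<lambda>y. (1 + y) powr (- a) * olver_2F1_series a b (2 * b) (2 * y / (1 + y)))
          has_fps_expansion L" by simp
  define H where "H = olver_fps (a / 2) (a / 2 + 1 / 2) (b + 1 / 2)"
  have R: "(\<lambda>y. quad_const b * (olver_2F1_series (a / 2) (a / 2 + 1 / 2) (b + 1 / 2) \<circ> (\<lambda>y. y\<^sup>2)) y)
          has_fps_expansion fps_const (quad_const b) * fps_compose H (fps_X ^ 2)"
    unfolding H_def
    by (intro has_fps_expansion_cmult_left has_fps_expansion_compose has_fps_expansion_olver_series
          has_fps_expansion_fps_X_power) simp
  have "L = fps_const (quad_const b) * fps_compose H (fps_X ^ 2)"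
  proof (rule fps_ext)
    fix n
    have "fps_nth L n = (\<Sum>k\<le>n. (pochhammer a k * (pochhammer b k * rGamma (2 * b + of_nat k)) / fact k) * 2 ^ k
                  * (- 1) ^ (n - k) * pochhammer (a + of_nat k) (n - k) / fact (n - k))"
      by (simp add: L_def olver_fps_def mult_ac)
    also have "\<dots> = pochhammer a n / fact n
          * binomial_transform (- 1) 2 (\<lambda>k. pochhammer b k * rGamma (2 * b + of_nat k)) n"
      unfolding euler_transform_coefficient ..
    finally have Ln: "fps_nth L n = \<dots>" .
    have Rn: "fps_nth (fps_compose H (fps_X ^ 2)) n = (if even n then fps_nth H (n div 2) else 0)"
    proof -
      have "fps_nth (fps_compose H (fps_X ^ 2)) n = (\<Sum>i=0..n. if n = 2 * i then fps_nth H i else 0)"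
        unfolding fps_compose_nth
        by (intro sum.cong refl) (simp add: fps_X_power_nth flip: power_mult)
      also have "\<dots> = (\<Sum>i\<in>{i\<in>{0..n}. n = 2 * i}. fps_nth H i)"
        by (rule sum.inter_filter [symmetric]) simp
      also have "{i\<in>{0..n}. n = 2 * i} = (if even n then {n div 2} else {})" by auto
      finally show ?thesis by simp
    qed
    show "fps_nth L n = fps_nth (fps_const (quad_const b) * fps_compose H (fps_X ^ 2)) n"
    proof (cases "even n")
      case False
      then obtain m where "n = Suc (2 * m)" by (metis oddE Suc_eq_plus1)
      then show ?thesis using Rn Ln quadratic_coefficients_odd[of b m] by simp
    next
      case True
      then obtain m where m: "n = 2 * m" by (elim evenE)
      have fact: "(fact (2 * m) :: complex) = 2 ^ (2 * m) * pochhammer (1/2) m * fact m"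
        using fact_double[of m, where 'a = complex] by simp
      have poch: "pochhammer a (2 * m) = 2 ^ (2 * m) * pochhammer (a / 2) m * pochhammer (a / 2 + 1 / 2) m"
        using pochhammer_double[of "a / 2" m] by simp
      have nz: "pochhammer (1/2 :: complex) m \<noteq> 0"
        using fact by (metis fact_nonzero mult_zero_left mult_zero_right)
      show ?thesis
        using Ln[unfolded m quadratic_coefficients_even fact poch] Rn[unfolded m] nz
        by (simp add: m H_def olver_fps_def)
    qed
  qed
  with L R show ?thesis
    unfolding has_fps_expansion_def by (auto elim: eventually_elim2)
qed

text \<open>
  This identity yields the analytic continuation: \<open>x \<mapsto> 4 x / (1 + x)\<^sup>2\<close> maps the unit disc
  onto the cut plane, so the right-hand side determines the values of the left-hand function
  everywhere in the cut plane.
\<close>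

lemma koebe_substitution_near_0:
  "eventually (\<lambda>x. (1 + x) powr (- (2 * a)) * olver_2F1_series a (a + 1 / 2) c (4 * x / (1 + x)\<^sup>2)
      = olver_2F1_series (2 * a) (2 * a - c + 1) c x) (nhds 0)"
proof -
  define L where "L = Abs_fps (\<lambda>n. \<Sum>k\<le>n. fps_nth (olver_fps a (a + 1 / 2) c) k * 4 ^ k * (- 1) ^ (n - k)
                       * pochhammer (2 * a + of_nat (2 * k)) (n - k) / fact (n - k))"
  have "(\<lambda>x. (1 + 1 * x) powr (- (2 * a)) * olver_2F1_series a (a + 1 / 2) c (4 * x / (1 + 1 * x) ^ 2))
          has_fps_expansion L"
    unfolding L_def
    by (rule has_fps_expansion_binomial_substitution[OF has_fps_expansion_olver_series])
  then have L: "(\<lambda>x. (1 + x) powr (- (2 * a)) * olver_2F1_series a (a + 1 / 2) c (4 * x / (1 + x)\<^sup>2))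
          has_fps_expansion L" by simp
  have "L = olver_fps (2 * a) (2 * a - c + 1) c"
  proof (rule fps_ext)
    fix n
    have term_eq: "fps_nth (olver_fps a (a + 1 / 2) c) k * 4 ^ k * (- 1) ^ (n - k)
                       * pochhammer (2 * a + of_nat (2 * k)) (n - k) / fact (n - k)
        = pochhammer (2 * a) n / fact n * (- 1) ^ n
          * (of_nat (n choose k) * 1 ^ (n - k) * (- 1) ^ k
             * (pochhammer (2 * a + of_nat n) k * rGamma (c + of_nat k)))" if k: "k \<le> n" for k
    proof -
      \<comment> \<open>duplication makes \<open>(a)\<^sub>k (a + 1/2)\<^sub>k\<close> merge with the binomial series; then \<open>(2 a)\<^sub>n\<close> splits off\<close>
      have "pochhammer (2 * a) (2 * k) * pochhammer (2 * a + of_nat (2 * k)) (n - k)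
              = pochhammer (2 * a) (n + k)"
        using pochhammer_product'[of "2 * a" "2 * k" "n - k"] k by (simp add: add.commute)
      also have "\<dots> = pochhammer (2 * a) n * pochhammer (2 * a + of_nat n) k"
        by (rule pochhammer_product')
      finally have 1: "4 ^ k * pochhammer a k * pochhammer (a + 1/2) k
          * pochhammer (2 * a + of_nat (2 * k)) (n - k)
          = pochhammer (2 * a) n * pochhammer (2 * a + of_nat n) k"
        by (simp add: pochhammer_double power_mult)
      have 2: "of_nat (n choose k) = (fact n / (fact k * fact (n - k)) :: complex)"
        using k by (rule binomial_fact)
      have 3: "(- 1 :: complex) ^ n * (- 1) ^ k = (- 1) ^ (n - k)"
        using k by (simp add: minus_one_power_iff)
      have "fps_nth (olver_fps a (a + 1 / 2) c) k * 4 ^ k * (- 1) ^ (n - k)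
                       * pochhammer (2 * a + of_nat (2 * k)) (n - k) / fact (n - k)
           = (4 ^ k * pochhammer a k * pochhammer (a + 1/2) k
               * pochhammer (2 * a + of_nat (2 * k)) (n - k)) * (- 1) ^ (n - k)
               * rGamma (c + of_nat k) / (fact k * fact (n - k))"
        by (simp add: olver_fps_def)
      then show ?thesis unfolding 1 2 3[symmetric] by simp
    qed
    have "fps_nth L n = (\<Sum>k\<le>n. pochhammer (2 * a) n / fact n * (- 1) ^ n
          * (of_nat (n choose k) * 1 ^ (n - k) * (- 1) ^ k
             * (pochhammer (2 * a + of_nat n) k * rGamma (c + of_nat k))))"
      unfolding L_def fps_nth_Abs_fps by (intro sum.cong term_eq) auto
    also have "\<dots> = pochhammer (2 * a) n / fact n * (- 1) ^ n
        * binomial_transform 1 (- 1) (\<lambda>k. pochhammer (2 * a + of_nat n) k * rGamma (c + of_nat k)) n"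
      unfolding binomial_transform_def by (simp only: sum_distrib_left)
    also have "\<dots> = pochhammer (2 * a) n / fact n
        * ((- 1) ^ n * pochhammer (c - 2 * a - of_nat n) n) * rGamma (c + of_nat n)"
      unfolding vandermonde_rGamma by (simp add: algebra_simps)
    also have "(- 1) ^ n * pochhammer (c - 2 * a - of_nat n) n = pochhammer (2 * a - c + 1) n"
      using pochhammer_minus'[of "2 * a + of_nat n - c" n] by (simp add: algebra_simps)
    finally show "fps_nth L n = fps_nth (olver_fps (2 * a) (2 * a - c + 1) c) n"
      by (simp add: olver_fps_def)
  qed
  with L has_fps_expansion_olver_series[of "2 * a" "2 * a - c + 1" c] show ?thesis
    unfolding has_fps_expansion_def by (auto elim: eventually_elim2)
qed

section \<open>Analytic continuation to the cut plane\<close>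

lemma cut_plane_iff: "w \<in> cut_plane \<longleftrightarrow> 1 - w \<notin> \<real>\<^sub>\<le>\<^sub>0"
proof -
  have "w \<in> complex_of_real ` {1..} \<longleftrightarrow> 1 - w \<in> \<real>\<^sub>\<le>\<^sub>0"
    by (auto simp: complex_nonpos_Reals_iff image_iff complex_eq_iff)
  then show ?thesis by (simp add: cut_plane_def)
qed

lemma closed_cut: "closed (complex_of_real ` {1..})"
proof -
  have "complex_of_real ` {1..} = {w. Im w = 0} \<inter> {w. Re w \<ge> 1}"
    by (auto simp: image_iff complex_eq_iff)
  then show ?thesis
    by (metis closed_Int closed_halfspace_Im_eq closed_halfspace_Re_ge)
qed

lemma open_cut_plane: "open cut_plane"
  unfolding cut_plane_def using closed_cut by (simp add: open_Compl)

lemma ball_subset_cut_plane: "ball 0 1 \<subseteq> cut_plane"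
  by (auto simp: cut_plane_def)

text \<open>
  The choice in the definition of \<open>olver_2F1\<close> is meaningful as soon as one continuation exists,
  and it suffices that this continuation agrees with the series near the origin.
\<close>

lemma olver_2F1_continuation:
  assumes F: "F holomorphic_on cut_plane"
    and eq: "eventually (\<lambda>w. F w = olver_2F1_series a b c w) (nhds 0)"
  shows olver_2F1_holomorphic: "olver_2F1 a b c holomorphic_on cut_plane"
    and olver_2F1_eq_series: "\<And>w. w \<in> ball 0 1 \<Longrightarrow> olver_2F1 a b c w = olver_2F1_series a b c w"
proof -
  have "F has_fps_expansion olver_fps a b c"
    using has_fps_expansion_olver_series eq
    by (rule has_fps_expansion_transfer[OF _ eventually_mono]) simp
  moreover have "F holomorphic_on ball 0 1"
    using F ball_subset_cut_plane by (rule holomorphic_on_subset)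
  ultimately have "\<forall>w\<in>ball 0 1. F w = olver_2F1_series a b c w"
    using has_fps_expansion_imp_eval_fps_eq[of F "olver_fps a b c" _ 1]
    by (simp add: olver_2F1_series_eq_eval_fps)
  with F have "\<exists>F. F holomorphic_on cut_plane \<and> (\<forall>w\<in>ball 0 1. F w = olver_2F1_series a b c w)"
    by blast
  from someI_ex[OF this]
  show "olver_2F1 a b c holomorphic_on cut_plane"
    and "\<And>w. w \<in> ball 0 1 \<Longrightarrow> olver_2F1 a b c w = olver_2F1_series a b c w"
    unfolding olver_2F1_def by blast+
qed

lemma eventually_subst_near_0:
  fixes g :: "complex \<Rightarrow> complex"
  assumes "eventually P (nhds 0)" "g holomorphic_on S" "open S" "0 \<in> S" "g 0 = 0"
  shows "eventually (\<lambda>w. P (g w)) (nhds 0)"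
proof -
  have "isCont g 0"
    using assms(2,3,4) by (metis continuous_on_eq_continuous_at holomorphic_on_imp_continuous_on)
  then have "filterlim g (nhds 0) (nhds 0)"
    using assms(5) by (metis isCont_def tendsto_at_iff_tendsto_nhds)
  with assms(1) show ?thesis by (rule eventually_compose_filterlim)
qed

text \<open>
  The map \<open>\<xi>\<close> is the inverse of \<open>x \<mapsto> 4 x / (1 + x)\<^sup>2\<close> on the cut plane.  It takes values in the
  unit disc because the principal square root of \<open>1 - w\<close> has positive real part.
\<close>

lemma half_step_continuation_exists:
  shows "\<exists>F. F holomorphic_on cut_plane
     \<and> eventually (\<lambda>w. F w = olver_2F1_series a (a + 1/2) c w) (nhds 0)"
proof -
  define \<xi> where "\<xi> = (\<lambda>w. (1 - csqrt (1 - w)) / (1 + csqrt (1 - w)))"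
  define F where "F = (\<lambda>w. (1 + \<xi> w) powr (2 * a) * olver_2F1_series (2 * a) (2 * a - c + 1) c (\<xi> w))"
  have Re: "Re (csqrt (1 - w)) > 0" if "w \<in> cut_plane" for w
  proof (rule ccontr)
    assume "\<not> ?thesis"
    moreover have "Re (csqrt (1 - w)) \<ge> 0" using csqrt_principal[of "1 - w"] by linarith
    ultimately have "Re (csqrt (1 - w)) = 0" by linarith
    then have "(csqrt (1 - w))\<^sup>2 \<in> \<real>\<^sub>\<le>\<^sub>0"
      by (simp add: complex_nonpos_Reals_iff Re_power2 Im_power2 del: power2_csqrt csqrt.sel)
    then show False using that by (simp add: cut_plane_iff)
  qed
  have nz: "1 + csqrt (1 - w) \<noteq> 0" if "w \<in> cut_plane" for w
  proof
    assume "1 + csqrt (1 - w) = 0"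
    then have "Re (1 + csqrt (1 - w)) = 0" by (metis zero_complex.sel(1))
    then show False using Re[OF that] unfolding plus_complex.sel one_complex.sel by linarith
  qed
  have hol: "\<xi> holomorphic_on cut_plane"
    unfolding \<xi>_def using nz by (intro holomorphic_intros) (auto simp: cut_plane_iff)
  have "norm (\<xi> w) < 1" if "w \<in> cut_plane" for w
  proof -
    define r where "r = csqrt (1 - w)"
    have "(norm (1 - r))\<^sup>2 < (norm (1 + r))\<^sup>2" if "Re r > 0" for r
      using that unfolding cmod_power2 by (simp add: power2_eq_square algebra_simps)
    then have "(norm (1 - r))\<^sup>2 < (norm (1 + r))\<^sup>2"
      using Re[OF that] unfolding r_def .
    then have "norm (1 - r) < norm (1 + r)" by (rule power_less_imp_less_base) simp
    then show ?thesis using nz[OF that] by (simp add: \<xi>_def r_def norm_divide)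
  qed
  then have ball: "\<xi> w \<in> ball 0 1" if "w \<in> cut_plane" for w using that by simp
  have pos: "1 + u \<notin> \<real>\<^sub>\<le>\<^sub>0" if "u \<in> ball 0 1" for u :: complex
    using that abs_Re_le_cmod[of u] by (auto simp: complex_nonpos_Reals_iff)
  have "olver_2F1_series (2 * a) (2 * a - c + 1) c \<circ> \<xi> holomorphic_on cut_plane"
    using ball by (intro holomorphic_on_compose_gen[OF hol olver_2F1_series_holomorphic]) auto
  then have "F holomorphic_on cut_plane"
    unfolding F_def using hol ball pos by (intro holomorphic_intros) (auto simp: o_def)
  moreover have "eventually (\<lambda>w. F w = olver_2F1_series a (a + 1/2) c w) (nhds 0)"
  proof -
    have in_cut: "eventually (\<lambda>w. w \<in> cut_plane) (nhds 0)"
      using open_cut_plane ball_subset_cut_plane by (intro eventually_nhds_in_open) auto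
    have "eventually (\<lambda>w. (1 + \<xi> w) powr (- (2 * a)) * olver_2F1_series a (a + 1 / 2) c (4 * \<xi> w / (1 + \<xi> w)\<^sup>2)
      = olver_2F1_series (2 * a) (2 * a - c + 1) c (\<xi> w)) (nhds 0)"
      by (rule eventually_subst_near_0[OF koebe_substitution_near_0 hol open_cut_plane])
         (auto simp: \<xi>_def cut_plane_iff)
    with in_cut show ?thesis
    proof eventually_elim
      case (elim w)
      define r where "r = csqrt (1 - w)"
      have r: "1 + r \<noteq> 0" "r\<^sup>2 = 1 - w" using nz[OF elim(1)] by (simp_all add: r_def)
      have \<xi>: "\<xi> w = (1 - r) / (1 + r)" by (simp add: \<xi>_def r_def)
      have 1: "1 + \<xi> w = 2 / (1 + r)" using r by (simp add: \<xi> field_simps)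
      have "4 * \<xi> w / (1 + \<xi> w)\<^sup>2 = (1 - r) * (1 + r)"
      proof -
        have "4 * (t / s) / (2 / s)\<^sup>2 = t * s" if "s \<noteq> 0" for s t :: complex
          using that by (simp add: power2_eq_square field_simps)
        from this[OF r(1), of "1 - r"] show ?thesis by (simp only: 1) (simp only: \<xi>)
      qed
      also have "\<dots> = w" using r(2) by (simp add: algebra_simps power2_eq_square)
      finally have "(1 + \<xi> w) powr (- (2 * a)) * olver_2F1_series a (a + 1 / 2) c w
        = olver_2F1_series (2 * a) (2 * a - c + 1) c (\<xi> w)" using elim by simp
      moreover have "1 + \<xi> w \<noteq> 0" using 1 r by simp
      ultimately show ?case
        unfolding F_def by (simp add: powr_minus field_simps)
    qed
  qed
  ultimately show ?thesis by blast
qed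

lemma square_in_cut_plane_iff:
  fixes y :: complex
  shows "y\<^sup>2 \<in> cut_plane \<longleftrightarrow> Im y \<noteq> 0 \<or> \<bar>Re y\<bar> < 1"
proof -
  have "1 - y\<^sup>2 \<in> \<real>\<^sub>\<le>\<^sub>0 \<longleftrightarrow> Im y = 0 \<and> 1 \<le> \<bar>Re y\<bar>"
  proof (cases "Im y = 0")
    case True
    then show ?thesis
      using abs_le_square_iff[of 1 "Re y"]
      by (simp add: complex_nonpos_Reals_iff Re_power2 Im_power2)
  next
    case False
    then have "0 < (Im y)\<^sup>2" by simp
    then show ?thesis
      using False by (auto simp: complex_nonpos_Reals_iff Re_power2 Im_power2)
        (use \<open>0 < (Im y)\<^sup>2\<close> in linarith)
  qed
  then show ?thesis by (auto simp: cut_plane_iff)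
qed

lemma not_nonpos_of_square_in_cut_plane:
  fixes y :: complex
  assumes "y\<^sup>2 \<in> cut_plane"
  shows "1 + y \<notin> \<real>\<^sub>\<le>\<^sub>0" "1 - y \<notin> \<real>\<^sub>\<le>\<^sub>0"
  using assms by (auto simp: complex_nonpos_Reals_iff square_in_cut_plane_iff)

text \<open>
  The map \<open>w \<mapsto> w / (2 - w)\<close> inverts \<open>y \<mapsto> 2 y / (1 + y)\<close>, the substitution in \<open>quadratic_near_0\<close>.
\<close>

lemma square_of_inverse_in_cut_plane:
  fixes w :: complex
  assumes "w \<in> cut_plane"
  shows "(w / (2 - w))\<^sup>2 \<in> cut_plane" "2 - w \<noteq> 0"
proof -
  show nz: "2 - w \<noteq> 0"
  proof
    assume "2 - w = 0"
    then have "w = of_real 2" by simp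
    then show False using assms unfolding cut_plane_def by (metis Compl_iff atLeast_iff image_eqI one_le_numeral)
  qed
  define y where "y = w / (2 - w)"
  have yw: "1 - w = (1 - y) / (1 + y)" "1 + y = 2 / (2 - w)" using nz by (simp_all add: y_def field_simps)
  show "(w / (2 - w))\<^sup>2 \<in> cut_plane"
  proof (rule ccontr)
    assume "\<not> ?thesis"
    then obtain x where x: "x \<ge> 1" "y\<^sup>2 = of_real x" by (auto simp: cut_plane_def y_def)
    then have "y\<^sup>2 = (of_real (sqrt x))\<^sup>2" by (simp flip: of_real_power)
    then obtain t where t: "y = of_real t" "t\<^sup>2 \<ge> 1"
      using x by (metis of_real_minus power2_eq_iff real_sqrt_pow2 order_trans zero_le_one)
    have "1 - w = of_real ((1 - t) / (1 + t))" using yw t by simp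
    moreover have "(1 - t) / (1 + t) \<le> 0"
      using t(2) abs_le_square_iff[of 1 t] by (auto simp: divide_le_0_iff abs_if split: if_splits)
    ultimately have "1 - w \<in> \<real>\<^sub>\<le>\<^sub>0" by (simp only: nonpos_Reals_of_real_iff)
    then show False using assms by (simp add: cut_plane_iff)
  qed
qed

lemma olver_2F1_half_step:
  shows olver_2F1_half_step_holomorphic: "olver_2F1 a (a + 1/2) c holomorphic_on cut_plane"
    and olver_2F1_half_step_series: "w \<in> ball 0 1 \<Longrightarrow> olver_2F1 a (a + 1/2) c w = olver_2F1_series a (a + 1/2) c w"
  using half_step_continuation_exists[of a c] olver_2F1_continuation by blast+

text \<open>
  The continuation for \<open>c = 2 b\<close> is read off from \<open>quadratic_near_0\<close>, whose right-hand side has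
  already been continued.
\<close>

lemma olver_2F1_double:
  shows olver_2F1_double_holomorphic: "olver_2F1 a b (2 * b) holomorphic_on cut_plane"
    and olver_2F1_double_series: "w \<in> ball 0 1 \<Longrightarrow> olver_2F1 a b (2 * b) w = olver_2F1_series a b (2 * b) w"
proof -
  define H where "H = olver_2F1 (a / 2) (a / 2 + 1/2) (b + 1/2)"
  define F where "F = (\<lambda>w. quad_const b * (2 / (2 - w)) powr a * H ((w / (2 - w))\<^sup>2))"
  have y: "1 + w / (2 - w) = 2 / (2 - w)" if "w \<in> cut_plane" for w
    using square_of_inverse_in_cut_plane[OF that] by (simp add: field_simps)
  have y_hol: "(\<lambda>w. w / (2 - w)) holomorphic_on cut_plane"
    using square_of_inverse_in_cut_plane by (intro holomorphic_intros) auto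
  have "H \<circ> (\<lambda>w. (w / (2 - w))\<^sup>2) holomorphic_on cut_plane"
    unfolding H_def using square_of_inverse_in_cut_plane
    by (intro holomorphic_on_compose_gen[OF _ olver_2F1_half_step_holomorphic] holomorphic_on_power y_hol) auto
  moreover have "2 / (2 - w) \<notin> \<real>\<^sub>\<le>\<^sub>0" if "w \<in> cut_plane" for w
    using not_nonpos_of_square_in_cut_plane(1)[OF square_of_inverse_in_cut_plane(1)[OF that]] y[OF that] by simp
  ultimately have F: "F holomorphic_on cut_plane"
    unfolding F_def using square_of_inverse_in_cut_plane
    by (intro holomorphic_intros) (auto simp: o_def)
  have "eventually (\<lambda>w. F w = olver_2F1_series a b (2 * b) w) (nhds 0)"
  proof -
    have in_cut: "eventually (\<lambda>w. w \<in> cut_plane) (nhds 0)"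
      using open_cut_plane ball_subset_cut_plane by (intro eventually_nhds_in_open) auto
    have small: "eventually (\<lambda>y. y\<^sup>2 \<in> ball 0 1) (nhds (0 :: complex))"
    proof (rule eventually_subst_near_0[where S = UNIV and g = "\<lambda>y. y\<^sup>2" and P = "\<lambda>y. y \<in> ball 0 1"])
      show "eventually (\<lambda>y. y \<in> ball 0 1) (nhds (0 :: complex))"
        by (intro eventually_nhds_in_open) auto
    qed (auto intro!: holomorphic_intros)
    have "eventually (\<lambda>w. let y = w / (2 - w) in y\<^sup>2 \<in> ball 0 1 \<and>
        (1 + y) powr (- a) * olver_2F1_series a b (2 * b) (2 * y / (1 + y))
      = quad_const b * olver_2F1_series (a / 2) (a / 2 + 1 / 2) (b + 1 / 2) (y\<^sup>2)) (nhds 0)"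
      unfolding Let_def
      by (rule eventually_subst_near_0[OF eventually_conj[OF small quadratic_near_0] y_hol open_cut_plane])
         (auto simp: cut_plane_iff)
    with in_cut show ?thesis
    proof eventually_elim
      case (elim w)
      define y where "y = w / (2 - w)"
      have nz: "2 - w \<noteq> 0" using square_of_inverse_in_cut_plane[OF elim(1)] by simp
      have y1: "1 + y = 2 / (2 - w)" using y[OF elim(1)] by (simp add: y_def)
      have "2 * y / (1 + y) = w" unfolding y1 using nz by (simp add: y_def)
      then have "(1 + y) powr (- a) * olver_2F1_series a b (2 * b) w = quad_const b * H (y\<^sup>2)"
        using elim(2) by (simp add: y_def[symmetric] Let_def H_def olver_2F1_half_step_series)
      moreover have "1 + y \<noteq> 0" using y1 nz by simp
      ultimately show ?case
        unfolding F_def y1[symmetric] y_def[symmetric] by (simp add: powr_minus field_simps)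
    qed
  qed
  with F show "olver_2F1 a b (2 * b) holomorphic_on cut_plane"
    "w \<in> ball 0 1 \<Longrightarrow> olver_2F1 a b (2 * b) w = olver_2F1_series a b (2 * b) w"
    using olver_2F1_continuation by blast+
qed

section \<open>The quadratic transformation on the doubly cut plane\<close>

text \<open>
  The set \<open>S\<close> is the plane without the two real rays \<open>(-\<infinity>, -1]\<close> and \<open>[1, \<infinity>)\<close>; it is the image of
  the exterior of \<open>[-1, 1]\<close>, with the point at infinity added, under \<open>z \<mapsto> 1 / z\<close>.
\<close>

lemma double_cut_plane:
  defines "S \<equiv> {y :: complex. y\<^sup>2 \<in> cut_plane}"
  shows open_double_cut_plane: "open S" and connected_double_cut_plane: "connected S"
proof -
  have "open ((\<lambda>y :: complex. y\<^sup>2) -` cut_plane)"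
    by (intro open_vimage open_cut_plane continuous_intros)
  then show "open S" by (simp add: S_def vimage_def)
  have "starlike S"
    unfolding starlike_def
  proof (intro bexI[of _ 0] ballI subsetI)
    fix y x assume y: "y \<in> S" and "x \<in> closed_segment 0 y"
    then obtain t where t: "0 \<le> t" "t \<le> 1" "x = of_real t * y"
      by (auto simp: closed_segment_def scaleR_conv_of_real)
    have "\<bar>t * Re y\<bar> \<le> \<bar>Re y\<bar>" using t by (simp add: abs_mult mult_left_le_one_le)
    with y t show "x \<in> S" by (auto simp: S_def square_in_cut_plane_iff)
  qed (simp add: S_def cut_plane_iff)
  then show "connected S" by (rule starlike_imp_connected)
qed

lemma moebius_into_cut_plane:
  fixes y :: complex
  assumes "y\<^sup>2 \<in> cut_plane"
  shows "2 * y / (y - 1) \<in> cut_plane" "y \<noteq> 1"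
proof -
  show y1: "y \<noteq> 1" using not_nonpos_of_square_in_cut_plane(2)[OF assms] by auto
  have q: "1 - 2 * y / (y - 1) = (1 + y) / (1 - y)" using y1 by (simp add: field_simps)
  show "2 * y / (y - 1) \<in> cut_plane"
  proof (rule ccontr)
    assume "\<not> ?thesis"
    then obtain s where s: "(1 + y) / (1 - y) = of_real s" "s \<le> 0"
      unfolding cut_plane_iff q by (auto elim!: nonpos_Reals_cases)
    then have "1 + y = of_real s * (1 - y)" using y1 by (simp add: field_simps)
    then have R: "1 + Re y = s * (1 - Re y)" and I: "(1 + s) * Im y = 0"
      by (simp_all add: complex_eq_iff algebra_simps)
    have "s \<noteq> -1" using R by auto
    then have "\<bar>Re y\<bar> < 1" using I assms by (simp add: square_in_cut_plane_iff)
    then have "0 < 1 + Re y" "0 < 1 - Re y" by auto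
    with R s(2) show False by (smt (verit) mult_nonpos_nonneg)
  qed
qed

text \<open>
  Two numbers with equal imaginary part, and on the same side of the origin if they are real,
  have arguments that differ by less than \<open>\<pi>\<close>.  This includes the negative real axis, where
  both arguments are \<open>\<pi>\<close>, so that quotients of principal powers may be merged on the cut as well.
\<close>

lemma Ln_divide_same_side:
  assumes "z \<noteq> 0" "w \<noteq> 0" "Im w = Im z" "Im z = 0 \<Longrightarrow> 0 < Re w \<longleftrightarrow> 0 < Re z"
  shows "Ln (w / z) = Ln w - Ln z"
proof (rule Ln_unique)
  show "exp (Ln w - Ln z) = w / z" using assms by (simp add: exp_diff)
  have "\<bar>Im (Ln w) - Im (Ln z)\<bar> < pi"
  proof (cases "Im z" "0 :: real" rule: linorder_cases)
    case less
    have *: "- pi < Im (Ln u) \<and> Im (Ln u) < 0" if "Im u < 0" for u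
      using that Im_Ln_pos_le[of u] mpi_less_Im_Ln[of u] Im_Ln_le_pi[of u] by fastforce
    have "Im w < 0" using less assms(3) by simp
    from *[OF less] *[OF this] show ?thesis by linarith
  next
    case greater
    then show ?thesis using assms(3) Im_Ln_pos_lt_imp[of z] Im_Ln_pos_lt_imp[of w] by (simp add: abs_if)
  next
    case equal
    have "Im (Ln w) = Im (Ln z)"
    proof (cases "0 < Re z")
      case True
      then show ?thesis using equal assms by (metis Im_Ln_eq_0)
    next
      case False
      have "Re u < 0" if "u \<noteq> 0" "Im u = 0" "\<not> 0 < Re u" for u
        using that by (auto simp: complex_eq_iff)
      then show ?thesis using False equal assms by (metis Im_Ln_eq_pi)
    qed
    then show ?thesis by simp
  qed
  then show "- pi < Im (Ln w - Ln z)" "Im (Ln w - Ln z) \<le> pi" by auto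
qed

lemma powr_divide_of_Ln:
  fixes w z s :: complex
  assumes "Ln (w / z) = Ln w - Ln z" "w \<noteq> 0" "z \<noteq> 0"
  shows "(w / z) powr s = w powr s / z powr s"
  using assms(2,3) by (simp add: powr_def assms(1) right_diff_distrib exp_diff)

text \<open>
  With \<open>x = 2 y / (1 + y)\<close> one has \<open>- x / (1 - x) = 2 y / (y - 1)\<close>.  Pfaff's transformation leads from
  the value at this point to the series with \<open>2 b - a\<close> in place of \<open>a\<close> at \<open>x\<close>, to which
  \<open>quadratic_near_0\<close> applies.
\<close>

lemma quadratic_transformation_near_0:
  "eventually (\<lambda>y. olver_2F1_series a b (2 * b) (2 * y / (y - 1)) =
      quad_const b * (1 - y) powr b * (1 + y) powr (b - a)
        * olver_2F1_series (b - a / 2) (b - a / 2 + 1/2) (b + 1/2) (y\<^sup>2)) (nhds 0)"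
proof -
  have ball: "eventually (\<lambda>y. y \<in> ball 0 1) (nhds (0 :: complex))"
    by (intro eventually_nhds_in_open) auto
  have hol: "(\<lambda>y. 2 * y / (1 + y)) holomorphic_on ball (0 :: complex) 1"
  proof (intro holomorphic_intros)
    fix y :: complex assume "y \<in> ball 0 1"
    then show "1 + y \<noteq> 0" by (metis add_eq_0_iff mem_ball_0 norm_minus_cancel norm_one less_irrefl)
  qed
  have "eventually (\<lambda>y. (1 - 2 * y / (1 + y)) powr (- b)
            * olver_2F1_series a b (2 * b) (- (2 * y / (1 + y)) / (1 - 2 * y / (1 + y)))
          = olver_2F1_series (2 * b - a) b (2 * b) (2 * y / (1 + y))) (nhds 0)"
    by (rule eventually_subst_near_0[OF pfaff_near_0 hol]) auto
  with ball quadratic_near_0[of "2 * b - a" b] show ?thesis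
  proof eventually_elim
    case (elim y)
    have "Re (1 + y) > 0" "Re (1 - y) > 0"
      using elim(1) abs_Re_le_cmod[of y] by auto
    then have arg: "\<bar>Im (Ln (1 + y))\<bar> < pi / 2" "\<bar>Im (Ln (1 - y))\<bar> < pi / 2"
      and nz: "1 + y \<noteq> 0" "1 - y \<noteq> 0"
      using Re_Ln_pos_lt_imp by (blast, blast, force+)
    then have nz: "1 + y \<noteq> 0" "1 - y \<noteq> 0" "y - 1 \<noteq> 0" by auto
    have 1: "1 - 2 * y / (1 + y) = (1 - y) / (1 + y)" using nz by (simp add: field_simps)
    have "Ln ((1 - y) / (1 + y)) = Ln (1 - y) - Ln (1 + y)"
      using arg nz by (intro Ln_unique) (auto simp: exp_diff)
    then have pw: "((1 - y) / (1 + y)) powr b = (1 - y) powr b / (1 + y) powr b"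
      using nz by (intro powr_divide_of_Ln)
    have 2: "- (2 * y / (1 + y)) / (1 - 2 * y / (1 + y)) = 2 * y / (y - 1)"
      unfolding 1 using nz by (simp add: divide_simps) (simp add: algebra_simps)
    define f where "f = olver_2F1_series a b (2 * b) (2 * y / (y - 1))"
    define g where "g = olver_2F1_series (2 * b - a) b (2 * b) (2 * y / (1 + y))"
    define h where "h = olver_2F1_series (b - a / 2) (b - a / 2 + 1/2) (b + 1/2) (y\<^sup>2)"
    have e1: "((1 - y) / (1 + y)) powr (- b) * f = g"
      using elim(3) unfolding 2 unfolding 1 f_def g_def .
    have e2: "(1 + y) powr (- (2 * b - a)) * g = quad_const b * h"
      using elim(2) by (simp add: g_def h_def diff_divide_distrib)
    have "f = ((1 - y) / (1 + y)) powr b * g"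
      unfolding e1[symmetric] using nz by (simp add: powr_minus field_simps)
    also have "g = (1 + y) powr (2 * b - a) * (quad_const b * h)"
      unfolding e2[symmetric] using nz by (simp add: mult.assoc [symmetric] flip: powr_add)
    also have "((1 - y) / (1 + y)) powr b * ((1 + y) powr (2 * b - a) * (quad_const b * h))
        = quad_const b * (1 - y) powr b * ((1 + y) powr (2 * b - a) / (1 + y) powr b) * h"
      unfolding pw by simp
    also have "(1 + y) powr (2 * b - a) / (1 + y) powr b = (1 + y) powr (b - a)"
      by (simp flip: powr_diff)
    finally show ?case unfolding f_def h_def .
  qed
qed

text \<open>
  Both sides are holomorphic on the connected set of \<open>double_cut_plane\<close>.  The powers
  are holomorphic there because neither \<open>1 - y\<close> nor \<open>1 + y\<close> meets the nonpositive real axis.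
\<close>

theorem quadratic_transformation:
  assumes y: "y\<^sup>2 \<in> cut_plane"
  shows "olver_2F1 a b (2 * b) (2 * y / (y - 1)) =
      quad_const b * (1 - y) powr b * (1 + y) powr (b - a)
        * olver_2F1 (b - a / 2) (b - a / 2 + 1/2) (b + 1/2) (y\<^sup>2)"
proof -
  define S where "S = {y :: complex. y\<^sup>2 \<in> cut_plane}"
  define L where "L = (\<lambda>y. olver_2F1 a b (2 * b) (2 * y / (y - 1)))"
  define R where "R = (\<lambda>y. quad_const b * (1 - y) powr b * (1 + y) powr (b - a)
        * olver_2F1 (b - a / 2) (b - a / 2 + 1/2) (b + 1/2) (y\<^sup>2))"
  have S: "open S" "connected S" "0 \<in> S"
    using double_cut_plane by (simp_all add: S_def cut_plane_iff)
  have m_hol: "(\<lambda>y. 2 * y / (y - 1)) holomorphic_on S"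
    using moebius_into_cut_plane by (intro holomorphic_intros) (auto simp: S_def)
  have "olver_2F1 a b (2 * b) \<circ> (\<lambda>y. 2 * y / (y - 1)) holomorphic_on S"
    using moebius_into_cut_plane
    by (intro holomorphic_on_compose_gen[OF m_hol olver_2F1_double_holomorphic]) (auto simp: S_def)
  then have L: "L holomorphic_on S" by (simp add: L_def o_def)
  have "olver_2F1 (b - a / 2) (b - a / 2 + 1/2) (b + 1/2) \<circ> (\<lambda>y. y\<^sup>2) holomorphic_on S"
    by (intro holomorphic_on_compose_gen[OF _ olver_2F1_half_step_holomorphic] holomorphic_intros)
       (auto simp: S_def)
  then have R: "R holomorphic_on S"
    unfolding R_def using not_nonpos_of_square_in_cut_plane
    by (intro holomorphic_intros) (auto simp: S_def o_def)
  have in_S: "eventually (\<lambda>y. y \<in> S) (nhds 0)" using S by (intro eventually_nhds_in_open) auto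
  have small: "eventually (\<lambda>w :: complex. w \<in> ball 0 1) (nhds 0)"
    by (intro eventually_nhds_in_open) auto
  have "eventually (\<lambda>y :: complex. 2 * y / (y - 1) \<in> ball 0 1) (nhds 0)"
    by (rule eventually_subst_near_0[OF small m_hol S(1,3)]) simp
  moreover have "eventually (\<lambda>y :: complex. y\<^sup>2 \<in> ball 0 1) (nhds 0)"
    by (rule eventually_subst_near_0[OF small, of _ UNIV]) (auto intro!: holomorphic_intros)
  ultimately have "eventually (\<lambda>y. y \<in> S \<and> L y = R y) (nhds 0)"
    using in_S quadratic_transformation_near_0[of a b]
  proof eventually_elim
    case (elim y)
    then show ?case
      unfolding L_def R_def by (simp only: olver_2F1_double_series olver_2F1_half_step_series simp_thms)
  qed
  then obtain U where U: "open U" "0 \<in> U" "\<forall>y\<in>U. y \<in> S \<and> L y = R y"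
    unfolding eventually_nhds by blast
  have "L y = R y"
    by (rule analytic_continuation_open[of U S L R]) (use U S L R y in \<open>auto simp: S_def\<close>)
  then show ?thesis unfolding L_def R_def .
qed

lemma olver_2F1_commute: "olver_2F1 a b c = olver_2F1 b a c"
  by (simp add: olver_2F1_def olver_2F1_series_def mult.commute[of "pochhammer a _"])

section \<open>Jacobi and Gegenbauer functions of the second kind\<close>

lemma exterior_cases:
  assumes "z \<notin> complex_of_real ` {-1..1}"
  shows "Im z \<noteq> 0 \<or> 1 < \<bar>Re z\<bar>"
proof (rule ccontr)
  assume "\<not> ?thesis"
  then have "z = of_real (Re z)" "Re z \<in> {-1..1}" by (auto simp: complex_eq_iff)
  then show False using assms by blast
qed

lemma exterior_nonzero:
  assumes "z \<notin> complex_of_real ` {-1..1}"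
  shows "z \<noteq> 0" "z - 1 \<noteq> 0" "z + 1 \<noteq> 0"
  using exterior_cases[OF assms] by (auto simp: complex_eq_iff)

text \<open>
  The quadratic transformation at \<open>y = 1 / z\<close>, with the powers of \<open>1 \<plusminus> 1 / z\<close> distributed by
  \<open>Ln_divide_same_side\<close>.
\<close>

lemma olver_2F1_on_exterior:
  assumes z: "z \<notin> complex_of_real ` {-1..1}"
  shows "olver_2F1 a b (2 * b) (2 / (1 - z)) =
      quad_const b * (z - 1) powr b * (z + 1) powr (b - a) / z powr (2 * b - a)
        * olver_2F1 (b - a / 2) (b - a / 2 + 1/2) (b + 1/2) (1 / z\<^sup>2)"
proof -
  note z' = exterior_cases[OF z] and nz = exterior_nonzero[OF z]
  have "(1 / z)\<^sup>2 \<in> cut_plane"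
  proof (cases "Im z = 0")
    case False
    then show ?thesis using nz by (simp add: square_in_cut_plane_iff Im_divide)
  next
    case True
    then obtain x where x: "z = of_real x" "1 < \<bar>x\<bar>"
      using z' by (intro that[of "Re z"]) (auto simp: complex_eq_iff)
    then have "1 / z = of_real (1 / x)" "\<bar>1 / x\<bar> < 1" by simp_all
    then show ?thesis by (simp only: square_in_cut_plane_iff Re_complex_of_real simp_thms)
  qed
  note quad = quadratic_transformation[OF this, of a b]
  have args: "1 - 1 / z = (z - 1) / z" "1 + 1 / z = (z + 1) / z" "(1 / z)\<^sup>2 = 1 / z\<^sup>2"
    using nz by (simp_all add: diff_divide_distrib add_divide_distrib power_one_over)
  have arg: "2 * (1 / z) / (1 / z - 1) = 2 / (1 - z)"
  proof -
    have "1 / z - 1 = (1 - z) / z" using nz by (simp add: diff_divide_distrib)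
    then show ?thesis using nz by simp
  qed
  have "Ln ((z - 1) / z) = Ln (z - 1) - Ln z" "Ln ((z + 1) / z) = Ln (z + 1) - Ln z"
    using nz z' by (intro Ln_divide_same_side; force)+
  then have pw: "((z - 1) / z) powr s = (z - 1) powr s / z powr s"
    "((z + 1) / z) powr s = (z + 1) powr s / z powr s" for s
    using nz by (auto intro: powr_divide_of_Ln)
  have "z powr (2 * b - a) = z powr b * z powr (b - a)"
    by (simp flip: powr_add)
  then show ?thesis
    using quad unfolding args arg pw by simp
qed

lemma powr_2_times: "z \<noteq> 0 \<Longrightarrow> (2 * z) powr s = 2 powr s * z powr (s :: complex)"
  using Ln_times_of_real[of 2 z] by (simp add: powr_def exp_add algebra_simps Ln_of_real)

text \<open>
  The parameters \<open>a\<close> and \<open>b\<close> are those of the hypergeometric function of argument \<open>2 / (1 - z)\<close>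
  that corresponds to \<open>D\<close>.
\<close>

lemma gegenbauer_D_eq:
  assumes "z \<noteq> 0" "b = l + \<mu> + 1 / 2" "a = l + 1"
  shows "gegenbauer_D l \<mu> z =
    exp (\<i> * of_real pi * \<mu>) * Gamma (2 * b - a) / (Gamma \<mu> * (2 powr (2 * b - a) * z powr (2 * b - a)))
      * olver_2F1 (b - a / 2) (b - a / 2 + 1/2) (b + 1/2) (1 / z\<^sup>2)"
proof -
  have e: "2 * b - a = l + 2 * \<mu>" "b - a / 2 = l / 2 + \<mu>" "b + 1/2 = l + \<mu> + 1"
    by (simp_all add: assms(2,3) field_simps)
  show ?thesis
    unfolding e gegenbauer_D_def powr_2_times[OF assms(1)] ..
qed

lemma Gamma_nonzero_shift:
  fixes x y :: complex
  assumes "x \<notin> {- of_nat n - d | n :: nat. n \<ge> 0}" "y = x + d"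
  shows "Gamma y \<noteq> 0"
  unfolding Gamma_eq_zero_iff
proof
  assume "y \<in> \<int>\<^sub>\<le>\<^sub>0"
  then obtain n where "y = - of_nat n" by (auto elim: nonpos_Ints_cases')
  then have "x = - of_nat n - d" using assms(2) by (simp add: eq_diff_eq)
  then show False using assms(1) by blast
qed

lemma negative_naturals_shift:
  "{- of_nat n | n :: nat. n \<ge> 1} = ({- of_nat n - 1 | n :: nat. n \<ge> 0} :: complex set)"
proof safe
  fix n :: nat assume "n \<ge> 1"
  then show "\<exists>m. (- of_nat n :: complex) = - of_nat m - 1 \<and> 0 \<le> m"
    by (intro exI[of _ "n - 1"]) (simp add: of_nat_diff)
next
  fix n :: nat
  show "\<exists>m. (- of_nat n - 1 :: complex) = - of_nat m \<and> 1 \<le> m"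
    by (intro exI[of _ "Suc n"]) simp
qed

text \<open>
  With \<open>b = \<alpha> + \<gamma> + 1\<close> the powers of \<open>z - 1\<close> and \<open>z + 1\<close> produced by \<open>olver_2F1_on_exterior\<close>
  cancel those in the denominator of \<open>Q\<close> exactly.
\<close>

lemma jacobi_Q_equal_parameters:
  assumes z: "z \<notin> complex_of_real ` {-1..1}"
    and Gb: "Gamma (\<alpha> + \<gamma> + 1) \<noteq> 0" and Gm: "Gamma (\<alpha> + 1/2) \<noteq> 0" and Gs: "Gamma (2 * \<alpha> + \<gamma> + 1) \<noteq> 0"
  shows "jacobi_Q \<gamma> \<alpha> \<alpha> z =
          exp (- \<i> * of_real pi * (\<alpha> + 1 / 2)) * of_real (sqrt pi) * 2 powr (2 * \<alpha>)
            * (Gamma (\<alpha> + 1 / 2) * Gamma (\<alpha> + \<gamma> + 1) / Gamma (2 * \<alpha> + \<gamma> + 1))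
            * gegenbauer_D \<gamma> (\<alpha> + 1 / 2) z"
proof -
  define a b m s where "a = \<gamma> + 1" and "b = \<alpha> + \<gamma> + 1" and "m = \<alpha> + 1/2" and "s = 2 * b - a"
  define P M Z H where "P = (z - 1) powr b" and "M = (z + 1) powr \<alpha>" and "Z = z powr s"
    and "H = olver_2F1 (b - a / 2) (b - a / 2 + 1/2) (b + 1/2) (1 / z\<^sup>2)"
  have nz: "z \<noteq> 0" "z - 1 \<noteq> 0" "z + 1 \<noteq> 0" using exterior_nonzero[OF z] by auto
  have nz': "P \<noteq> 0" "M \<noteq> 0" "Z \<noteq> 0" "Gamma b \<noteq> 0" "Gamma m \<noteq> 0" "Gamma s \<noteq> 0"
    using nz Gb Gm Gs by (simp_all add: P_def M_def Z_def b_def m_def s_def a_def algebra_simps)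
  have F: "olver_2F1 (\<gamma> + 1) (\<alpha> + \<gamma> + 1) (\<alpha> + \<alpha> + 2 * \<gamma> + 2) (2 / (1 - z))
           = quad_const b * P * M / Z * H"
    using olver_2F1_on_exterior[OF z, of a b]
    by (simp add: a_def b_def P_def M_def Z_def H_def s_def algebra_simps)
  have Q: "jacobi_Q \<gamma> \<alpha> \<alpha> z = 2 powr (2 * \<alpha> + \<gamma>) * Gamma b * Gamma b / (P * M) * (quad_const b * P * M / Z * H)"
    unfolding jacobi_Q_def F unfolding P_def M_def b_def mult_2 ..
  have D: "gegenbauer_D \<gamma> m z = exp (\<i> * of_real pi * m) * Gamma s / (Gamma m * (2 powr s * Z)) * H"
    unfolding s_def Z_def H_def
    by (rule gegenbauer_D_eq) (use nz in \<open>simp_all add: m_def b_def a_def\<close>)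
  define e where "e = exp (\<i> * of_real pi * m)"
  have "e \<noteq> 0" by (simp add: e_def)
  have E: "exp (- \<i> * of_real pi * m) = inverse (exp (\<i> * of_real pi * m))"
    by (simp add: exp_minus)
  have "2 powr (2 * \<alpha> + \<gamma>) * 2 powr (1 - 2 * b) = (2 powr (2 * \<alpha>) / 2 powr s :: complex)"
    by (simp add: s_def a_def b_def algebra_simps flip: powr_add powr_diff)
  then have two: "2 powr (2 * \<alpha> + \<gamma>) * quad_const b
      = of_real (sqrt pi) * (2 powr (2 * \<alpha>) / 2 powr s) * inverse (Gamma b)"
    unfolding quad_const_def rGamma_inverse_Gamma by (simp add: mult_ac)
  have "jacobi_Q \<gamma> \<alpha> \<alpha> z = (2 powr (2 * \<alpha> + \<gamma>) * quad_const b) * Gamma b * Gamma b / Z * H"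
    unfolding Q using nz' by simp
  also have "\<dots> = of_real (sqrt pi) * (2 powr (2 * \<alpha>) / 2 powr s) * Gamma b / Z * H"
    unfolding two using nz' by simp
  also have "\<dots> = exp (- \<i> * of_real pi * m) * of_real (sqrt pi) * 2 powr (2 * \<alpha>)
            * (Gamma m * Gamma b / Gamma s) * gegenbauer_D \<gamma> m z"
    unfolding D E e_def [symmetric] using nz' \<open>e \<noteq> 0\<close> by simp
  finally show ?thesis
    by (simp add: m_def b_def s_def a_def algebra_simps)
qed

text \<open>
  Now \<open>b = \<gamma> + 1\<close>, so the roles of the two numerator parameters are exchanged and one power of
  \<open>z - 1\<close> survives.  If \<open>\<gamma>\<close> is a negative integer, then \<open>quad_const b\<close> and \<open>1 / \<Gamma>(2 \<gamma> + 2)\<close> both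
  vanish, and the two sides are \<open>0\<close>.
\<close>

lemma jacobi_Q_opposite_parameters:
  assumes z: "z \<notin> complex_of_real ` {-1..1}"
    and Gm: "Gamma (1/2 - \<alpha>) \<noteq> 0" and Gh: "Gamma (\<gamma> + 3/2) \<noteq> 0"
  shows "jacobi_Q \<gamma> \<alpha> (- \<alpha>) z =
          exp (\<i> * of_real pi * (\<alpha> - 1 / 2)) * 2 powr (2 * \<gamma> - \<alpha> + 1)
            * (Gamma (\<alpha> + \<gamma> + 1) * Gamma (1 / 2 - \<alpha>) * Gamma (\<gamma> + 3 / 2)
               / (Gamma (2 * \<gamma> + 2) * (z - 1) powr \<alpha>))
            * gegenbauer_D (\<alpha> + \<gamma>) (1 / 2 - \<alpha>) z"
proof -
  define a b m s where "a = \<alpha> + \<gamma> + 1" and "b = \<gamma> + 1" and "m = 1/2 - \<alpha>" and "s = 2 * b - a"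
  define P N M Z H where "P = (z - 1) powr b" and "N = (z - 1) powr \<alpha>"
    and "M = (z + 1) powr (- \<alpha>)" and "Z = z powr s"
    and "H = olver_2F1 (b - a / 2) (b - a / 2 + 1/2) (b + 1/2) (1 / z\<^sup>2)"
  have nz: "z \<noteq> 0" "z - 1 \<noteq> 0" "z + 1 \<noteq> 0" using exterior_nonzero[OF z] by auto
  have nz': "P \<noteq> 0" "N \<noteq> 0" "M \<noteq> 0" "Z \<noteq> 0" "Gamma m \<noteq> 0"
    using nz Gm by (simp_all add: P_def N_def M_def Z_def m_def)
  have F: "olver_2F1 (\<gamma> + 1) (\<alpha> + \<gamma> + 1) (\<alpha> + - \<alpha> + 2 * \<gamma> + 2) (2 / (1 - z))
           = quad_const b * P * M / Z * H"
    unfolding olver_2F1_commute[of "\<gamma> + 1" "\<alpha> + \<gamma> + 1"]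
    using olver_2F1_on_exterior[OF z, of a b]
    by (simp add: a_def b_def P_def M_def Z_def H_def s_def algebra_simps)
  have PN: "(z - 1) powr (\<alpha> + \<gamma> + 1) = N * P"
    by (simp add: N_def P_def b_def add_ac flip: powr_add)
  have Q: "jacobi_Q \<gamma> \<alpha> (- \<alpha>) z = 2 powr \<gamma> * Gamma a * Gamma s / (N * P * M) * (quad_const b * P * M / Z * H)"
    unfolding jacobi_Q_def F PN unfolding M_def by (simp add: a_def b_def s_def algebra_simps)
  have D: "gegenbauer_D (\<alpha> + \<gamma>) m z = exp (\<i> * of_real pi * m) * Gamma s / (Gamma m * (2 powr s * Z)) * H"
    unfolding s_def Z_def H_def
    by (rule gegenbauer_D_eq) (use nz in \<open>simp_all add: m_def b_def a_def\<close>)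
  define e where "e = exp (\<i> * of_real pi * m)"
  have "e \<noteq> 0" by (simp add: e_def)
  have E: "exp (\<i> * of_real pi * (\<alpha> - 1/2)) = inverse (exp (\<i> * of_real pi * m))"
    unfolding exp_minus [symmetric] by (simp add: m_def algebra_simps)
  have two: "2 powr (2 * \<gamma> - \<alpha> + 1) / 2 powr s = (2 powr \<gamma> :: complex)"
    by (simp add: s_def a_def b_def algebra_simps flip: powr_diff)
  have "rGamma (2 * \<gamma> + 2) = quad_const b * rGamma (\<gamma> + 3/2)"
    using rGamma_legendre_duplication[of b] by (simp add: quad_const_def b_def algebra_simps)
  then have K: "quad_const b = Gamma (\<gamma> + 3/2) / Gamma (2 * \<gamma> + 2)"
    using Gh by (simp add: rGamma_inverse_Gamma field_simps)
  have "jacobi_Q \<gamma> \<alpha> (- \<alpha>) z = 2 powr \<gamma> * Gamma a * Gamma s / N * quad_const b / Z * H"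
    unfolding Q using nz' by simp
  also have "\<dots> = exp (\<i> * of_real pi * (\<alpha> - 1/2)) * 2 powr (2 * \<gamma> - \<alpha> + 1)
            * (Gamma a * Gamma m * Gamma (\<gamma> + 3 / 2) / (Gamma (2 * \<gamma> + 2) * N))
            * gegenbauer_D (\<alpha> + \<gamma>) m z"
    unfolding D E K two [symmetric] e_def [symmetric] using nz' \<open>e \<noteq> 0\<close> by (simp add: mult_ac)
  finally show ?thesis
    by (simp add: m_def a_def N_def)
qed

theorem theorem2p20:
  fixes \<alpha> \<gamma> z :: complex
  assumes z: "z \<notin> complex_of_real ` {-1..1}"
    and \<alpha>\<gamma>: "\<alpha> + \<gamma> \<notin> {- of_nat n | n::nat. n \<ge> 1}"
  shows
    "(\<alpha> \<notin> {- of_nat n - 1 / 2 | n::nat. n \<ge> 0} \<and> 2 * \<alpha> + \<gamma> \<notin> {- of_nat n | n::nat. n \<ge> 1} \<longrightarrow>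
        jacobi_Q \<gamma> \<alpha> \<alpha> z =
          exp (- \<i> * of_real pi * (\<alpha> + 1 / 2)) * of_real (sqrt pi) * 2 powr (2 * \<alpha>)
            * (Gamma (\<alpha> + 1 / 2) * Gamma (\<alpha> + \<gamma> + 1) / Gamma (2 * \<alpha> + \<gamma> + 1))
            * gegenbauer_D \<gamma> (\<alpha> + 1 / 2) z)
     \<and>
     (\<alpha> \<notin> {of_nat n + 1 / 2 | n::nat. n \<ge> 0} \<and> \<gamma> \<notin> {- of_nat n - 3 / 2 | n::nat. n \<ge> 0} \<and>
      \<gamma> - \<alpha> \<notin> {- of_nat n | n::nat. n \<ge> 1} \<longrightarrow>
        jacobi_Q \<gamma> \<alpha> (- \<alpha>) z =
          exp (\<i> * of_real pi * (\<alpha> - 1 / 2)) * 2 powr (2 * \<gamma> - \<alpha> + 1)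
            * (Gamma (\<alpha> + \<gamma> + 1) * Gamma (1 / 2 - \<alpha>) * Gamma (\<gamma> + 3 / 2)
               / (Gamma (2 * \<gamma> + 2) * (z - 1) powr \<alpha>))
            * gegenbauer_D (\<alpha> + \<gamma>) (1 / 2 - \<alpha>) z)"
proof (intro conjI impI)
  assume A: "\<alpha> \<notin> {- of_nat n - 1 / 2 | n::nat. n \<ge> 0} \<and> 2 * \<alpha> + \<gamma> \<notin> {- of_nat n | n::nat. n \<ge> 1}"
  show "jacobi_Q \<gamma> \<alpha> \<alpha> z =
          exp (- \<i> * of_real pi * (\<alpha> + 1 / 2)) * of_real (sqrt pi) * 2 powr (2 * \<alpha>)
            * (Gamma (\<alpha> + 1 / 2) * Gamma (\<alpha> + \<gamma> + 1) / Gamma (2 * \<alpha> + \<gamma> + 1))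
            * gegenbauer_D \<gamma> (\<alpha> + 1 / 2) z"
  proof (rule jacobi_Q_equal_parameters[OF z])
    show "Gamma (\<alpha> + \<gamma> + 1) \<noteq> 0"
      by (rule Gamma_nonzero_shift[OF \<alpha>\<gamma>[unfolded negative_naturals_shift] refl])
    show "Gamma (2 * \<alpha> + \<gamma> + 1) \<noteq> 0"
      by (rule Gamma_nonzero_shift[OF A[THEN conjunct2, unfolded negative_naturals_shift] refl])
    show "Gamma (\<alpha> + 1/2) \<noteq> 0"
      by (rule Gamma_nonzero_shift[OF A[THEN conjunct1] refl])
  qed
next
  assume A: "\<alpha> \<notin> {of_nat n + 1 / 2 | n::nat. n \<ge> 0} \<and> \<gamma> \<notin> {- of_nat n - 3 / 2 | n::nat. n \<ge> 0} \<and>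
      \<gamma> - \<alpha> \<notin> {- of_nat n | n::nat. n \<ge> 1}"
  show "jacobi_Q \<gamma> \<alpha> (- \<alpha>) z =
          exp (\<i> * of_real pi * (\<alpha> - 1 / 2)) * 2 powr (2 * \<gamma> - \<alpha> + 1)
            * (Gamma (\<alpha> + \<gamma> + 1) * Gamma (1 / 2 - \<alpha>) * Gamma (\<gamma> + 3 / 2)
               / (Gamma (2 * \<gamma> + 2) * (z - 1) powr \<alpha>))
            * gegenbauer_D (\<alpha> + \<gamma>) (1 / 2 - \<alpha>) z"
  proof (rule jacobi_Q_opposite_parameters[OF z])
    have "- \<alpha> \<notin> {- of_nat n - 1 / 2 | n::nat. n \<ge> 0}"
    proof
      assume "- \<alpha> \<in> {- of_nat n - 1 / 2 | n::nat. n \<ge> 0}"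
      then obtain n :: nat where "- \<alpha> = - (of_nat n + 1 / 2)" by auto
      then have "\<alpha> = of_nat n + 1 / 2" by (simp only: neg_equal_iff_equal)
      then have "\<alpha> \<in> {of_nat n + 1 / 2 | n::nat. n \<ge> 0}" by auto
      with A[THEN conjunct1] show False by (rule notE)
    qed
    then show "Gamma (1/2 - \<alpha>) \<noteq> 0" by (rule Gamma_nonzero_shift) simp
    show "Gamma (\<gamma> + 3/2) \<noteq> 0"
      by (rule Gamma_nonzero_shift[OF A[THEN conjunct2, THEN conjunct1] refl])
  qed
qed

end
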